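(* Let $A\subset \mathbb{R}^2$ be a closed set having property (K). Then the union of the nontrivial connected components of $A$ is a trivial (K)-set. If $A$ is nonempty, closed, connected and has property (K), then $A$ is a line segment, a half line, a line, a circular arc, a circle or a singleton.
   Context: Identify the plane $\mathbb{R}^2$ with $\mathbb{C}$. A rigid motion is an orientation-preserving isometry of the plane (a translation or a rotation), i.e. a map $x\mapsto ux+c$ with $u,c\in\mathbb{C}$, $|u|=1$. The identity map is denoted by $j$. A continuous movement $M$ is a map $t\mapsto M_t$ ($t\in[0,1]$) such that $M_t$ is a rigid motion for every $t\in[0,1]$, the map $(t,x)\mapsto M_t(x)$ is continuous on $[0,1]\times\mathbb{R}^2$, and $M_0=j$. For a set $A\subset\mathbb{R}^2$ put $W_M(A)=\{M_t(x)\colon t\in[0,1],\ x\in A\}$. Let $\lambda$ denote two-dimensional Lebesgue measure. The set $A$ has property (K) (the Kakeya property) if there is a rigid motion $\alpha\ne j$ such that for every $\varepsilon>0$ there exists a continuous movement $M$ with $M_1=\alpha$ and $\lambda(W_M(A))<\varepsilon$. A set $A\subset\mathbb{R}^2$ is a trivial (K)-set if $A$ can be covered by a null set (a set of two-dimensional Lebesgue measure zero) which is either the union of parallel lines or the union of concentric circles. A nontrivial connected component of a set is a connected component having at least two points. *)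

theory Defs
  imports "HOL-Analysis.Analysis"
begin

definition rigid_motion :: "(complex \<Rightarrow> complex) \<Rightarrow> bool" where
  "rigid_motion f \<longleftrightarrow> (\<exists>u c. norm u = 1 \<and> f = (\<lambda>x. u * x + c))"

(* Values M t for t outside {0..1} are irrelevant junk. *)
definition continuous_movement :: "(real \<Rightarrow> complex \<Rightarrow> complex) \<Rightarrow> bool" where
  "continuous_movement M \<longleftrightarrow>
     (\<forall>t\<in>{0..1}. rigid_motion (M t)) \<and>
     continuous_on ({0..1} \<times> UNIV) (\<lambda>(t, x). M t x) \<and>
     M 0 = id"

definition swept :: "(real \<Rightarrow> complex \<Rightarrow> complex) \<Rightarrow> complex set \<Rightarrow> complex set" where
  "swept M A = {M t x | t x. t \<in> {0..1} \<and> x \<in> A}"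

(* Measurability of the swept set is demanded explicitly because emeasure is 0 on
   non-measurable sets. It is automatic for closed A: then the swept set is the continuous
   image of a sigma-compact set. *)
definition kakeya_property :: "complex set \<Rightarrow> bool" where
  "kakeya_property A \<longleftrightarrow>
     (\<exists>\<alpha>. rigid_motion \<alpha> \<and> \<alpha> \<noteq> id \<and>
        (\<forall>\<epsilon>::real. \<epsilon> > 0 \<longrightarrow>
           (\<exists>M. continuous_movement M \<and> M 1 = \<alpha> \<and>
                swept M A \<in> sets lebesgue \<and> emeasure lebesgue (swept M A) < ennreal \<epsilon>)))"

definition is_line :: "complex set \<Rightarrow> bool" where
  "is_line L \<longleftrightarrow> (\<exists>a b. a \<noteq> b \<and> L = affine hull {a, b})"

definition union_of_parallel_lines :: "complex set \<Rightarrow> bool" where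
  "union_of_parallel_lines N \<longleftrightarrow>
     (\<exists>\<L>. (\<forall>L\<in>\<L>. is_line L) \<and> (\<forall>L\<in>\<L>. \<forall>L'\<in>\<L>. affine_parallel L L') \<and> N = \<Union>\<L>)"

definition union_of_concentric_circles :: "complex set \<Rightarrow> bool" where
  "union_of_concentric_circles N \<longleftrightarrow> (\<exists>c R. (\<forall>r\<in>R. r > 0) \<and> N = (\<Union>r\<in>R. sphere c r))"

definition trivial_K_set :: "complex set \<Rightarrow> bool" where
  "trivial_K_set A \<longleftrightarrow>
     (\<exists>N. A \<subseteq> N \<and> N \<in> null_sets lebesgue \<and>
          (union_of_parallel_lines N \<or> union_of_concentric_circles N))"

definition nontrivial_components :: "complex set \<Rightarrow> complex set set" where
  "nontrivial_components A = {C \<in> components A. \<exists>x\<in>C. \<exists>y\<in>C. x \<noteq> y}"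

definition is_line_segment :: "complex set \<Rightarrow> bool" where
  "is_line_segment S \<longleftrightarrow> (\<exists>a b. a \<noteq> b \<and> S = closed_segment a b)"

definition is_half_line :: "complex set \<Rightarrow> bool" where
  "is_half_line S \<longleftrightarrow> (\<exists>a v. v \<noteq> 0 \<and> S = {a + s *\<^sub>R v | s. s \<ge> 0})"

definition is_circle :: "complex set \<Rightarrow> bool" where
  "is_circle S \<longleftrightarrow> (\<exists>c r. r > 0 \<and> S = sphere c r)"

(* Arcs contain their endpoints and are neither a single point nor a full circle. *)
definition is_circular_arc :: "complex set \<Rightarrow> bool" where
  "is_circular_arc S \<longleftrightarrow>
     (\<exists>c r \<theta>\<^sub>1 \<theta>\<^sub>2. r > 0 \<and> \<theta>\<^sub>1 < \<theta>\<^sub>2 \<and> \<theta>\<^sub>2 < \<theta>\<^sub>1 + 2 * pi \<and>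
        S = {c + of_real r * cis \<theta> | \<theta>. \<theta> \<in> {\<theta>\<^sub>1..\<theta>\<^sub>2}})"

end

theory Submission imports Defs begin

text \<open>Stop each movement when it first leaves a small neighbourhood of the identity. The stopped
  motions converge in direction to an infinitesimal rotation or translation, with a flow \<open>\<phi>\<close>. A point
  outside the small swept set is carried by the inverse movement along a path that misses \<open>A\<close>;
  iterating, most points \<open>p\<close> are joined to a point near \<open>\<phi> s p\<close> outside \<open>A\<close>, close to the orbit of
  \<open>p\<close>. A subcontinuum of \<open>A\<close> transversal to the orbits would separate a flow box and block such
  paths. So by boundary bumping every point of a nontrivial component of \<open>A\<close> lies on an orbit arc
  contained in \<open>A\<close>. As \<open>A\<close> is null, only a null set of orbits, with empty interior, contains such
  arcs: these orbits (parallel lines or concentric circles) cover the nontrivial components, and each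
  component lies on a single orbit.\<close>

section \<open>Small movements and their generator\<close>

text \<open>The final motion \<alpha> is fixed while the swept measure tends to 0, so every movement
  must pass through each size \<delta> up to that of \<alpha>. Stopping at size exactly \<delta>
  keeps the displacements, divided by \<delta>, in a compact set away from 0; hence the limiting
  generator does not vanish. Inverses are used so that the point moves while \<open>A\<close> stands
  still: p lies outside the moved copy of \<open>A\<close> iff the inverse motion sends p outside
  \<open>A\<close>. The direction of a stopped movement is known only at its end. In between it may
  wander, though only by O(\<delta>) on bounded sets. Following the flow for time s takes about s /
  \<delta> repetitions, each of which excludes starting points of measure less than \<epsilon>. With
  \<epsilon> = \<delta>^2 the total loss is O((s + 1) \<delta>), so a good starting point exists in
  every ball once \<delta> is small. It cannot be prescribed, which is why the paths are played off
  against separation by a continuum, a property that tolerates small perturbations. Only an arc of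
  an orbit is known to lie in \<open>A\<close>; that the complete orbits still form a null set needs
  an argument of its own.\<close>

text \<open>Here \<open>p \<mapsto> v t * p + d t\<close> is the inverse of the movement at time \<open>t\<close>, and \<open>S\<close> contains the
  swept set.\<close>

definition small_move ::
  "complex set \<Rightarrow> real \<Rightarrow> real \<Rightarrow> (real \<Rightarrow> complex) \<Rightarrow> (real \<Rightarrow> complex) \<Rightarrow> bool" where
  "small_move A \<delta> \<epsilon> v d \<longleftrightarrow>
     continuous_on {0..1} v \<and> continuous_on {0..1} d \<and> v 0 = 1 \<and> d 0 = 0 \<and>
     (\<forall>t\<in>{0..1}. norm (v t) = 1 \<and> norm (v t - 1) + norm (d t) \<le> \<delta>) \<and>
     norm (v 1 - 1) + norm (d 1) = \<delta> \<and>
     (\<exists>S. open S \<and> S \<in> lmeasurable \<and> measure lebesgue S < \<epsilon> \<and>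
        (\<forall>p. p \<notin> S \<longrightarrow> (\<forall>t\<in>{0..1}. v t * p + d t \<notin> A)))"

text \<open>Provides the open exceptional set asked for in \<open>small_move\<close>: its preimages
  under rigid motions are open, hence measurable.\<close>

lemma lmeasurable_open_superset:
  fixes S :: "'a::euclidean_space set"
  assumes S: "S \<in> lmeasurable" and "measure lebesgue S < e"
  obtains T where "open T" "S \<subseteq> T" "T \<in> lmeasurable" "measure lebesgue T < e"
proof -
  obtain T where T: "open T" "S \<subseteq> T" "T - S \<in> lmeasurable"
    "emeasure lebesgue (T - S) < ennreal (e - measure lebesgue S)"
    using sets_lebesgue_outer_open[of S "e - measure lebesgue S"] assms by (auto simp: fmeasurableD)
  have eq: "T = S \<union> (T - S)" using T(2) by blast
  have "T \<in> lmeasurable" using fmeasurable.Un[OF S T(3)] eq by simp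
  moreover have "measure lebesgue (T - S) < e - measure lebesgue S"
    using T(3,4) assms by (simp add: emeasure_eq_measure2 ennreal_less_iff)
  then have "measure lebesgue T < e"
    using measure_Un_le[of S lebesgue "T - S"] S T(3) eq by (simp add: fmeasurableD)
  ultimately show ?thesis using T that by blast
qed

lemma first_hitting_time:
  fixes D :: "real \<Rightarrow> real"
  assumes cont: "continuous_on {0..1} D" and "D 0 < \<delta>" "\<delta> \<le> D 1"
  obtains T where "T \<in> {0..1}" "D T = \<delta>" "\<And>t. t \<in> {0..T} \<Longrightarrow> D t \<le> \<delta>"
proof -
  define B where "B = {t \<in> {0..1}. \<delta> \<le> D t}"
  have "closed B"
    using continuous_closed_preimage[OF cont closed_atLeastAtMost, of "{\<delta>..}"]
    by (simp add: B_def vimage_def Int_def)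
  moreover have "bounded B"
    by (rule bounded_subset[of "{0..1}"]) (auto simp: B_def)
  moreover have "1 \<in> B" using assms by (simp add: B_def)
  ultimately obtain T where T: "T \<in> B" "\<And>t. t \<in> B \<Longrightarrow> T \<le> t"
    using compact_attains_inf[of B] by (auto simp: compact_eq_bounded_closed)
  have le: "D t \<le> \<delta>" if "t \<in> {0..<T}" for t
    using T that by (force simp: B_def)
  \<comment> \<open>Membership of \<open>T\<close> in \<open>B\<close> gives only
    \<open>\<delta> \<le> D T\<close>. The intermediate value theorem finds a hit no later than
    \<open>T\<close>; it lies in \<open>B\<close>, so it is \<open>T\<close> itself.\<close>
  have "\<exists>t\<ge>0. t \<le> T \<and> D t = \<delta>"
    using T assms by (intro IVT' continuous_on_subset[OF cont]) (auto simp: B_def)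
  then obtain t where "0 \<le> t" "t \<le> T" "D t = \<delta>" by blast
  with T have "D T = \<delta>"
    by (metis (mono_tags, lifting) B_def atLeastAtMost_iff mem_Collect_eq order_antisym order_trans order_refl)
  with le T show ?thesis
    by (intro that[of T]) (force simp: B_def less_eq_real_def)+
qed

text \<open>\<open>\<delta>0\<close> depends on the final motion alone: it is the size of \<alpha>,
  measured as \<open>norm (u - 1) + norm c\<close>. By continuity every movement ending in \<alpha>
  takes each smaller size on the way, however small its swept set is.\<close>

lemma kakeya_small_moves:
  assumes "kakeya_property A"
  obtains \<delta>0 where "\<delta>0 > 0"
    "\<And>\<delta> \<epsilon>. 0 < \<delta> \<Longrightarrow> \<delta> \<le> \<delta>0 \<Longrightarrow> 0 < \<epsilon> \<Longrightarrow> \<exists>v d. small_move A \<delta> \<epsilon> v d"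
proof -
  from assms obtain \<alpha> where \<alpha>: "rigid_motion \<alpha>" "\<alpha> \<noteq> id"
    and mv: "\<And>\<epsilon>::real. \<epsilon> > 0 \<Longrightarrow> \<exists>M. continuous_movement M \<and> M 1 = \<alpha> \<and>
              swept M A \<in> sets lebesgue \<and> emeasure lebesgue (swept M A) < ennreal \<epsilon>"
    unfolding kakeya_property_def by blast
  from \<alpha> obtain u c where \<alpha>_eq: "\<alpha> = (\<lambda>x. u * x + c)" by (auto simp: rigid_motion_def)
  define \<delta>0 where "\<delta>0 = norm (u - 1) + norm c"
  show ?thesis
  proof (rule that[of \<delta>0])
    show "\<delta>0 > 0"
    proof (rule ccontr)
      assume "\<not> 0 < \<delta>0"
      then have "norm (u - 1) = 0 \<and> norm c = 0"
        unfolding \<delta>0_def by (smt (verit) norm_ge_zero)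
      then show False using \<alpha>(2) by (auto simp: \<alpha>_eq)
    qed
  next
    fix \<delta> \<epsilon> :: real assume \<delta>: "0 < \<delta>" "\<delta> \<le> \<delta>0" and \<epsilon>: "0 < \<epsilon>"
    obtain M where M: "continuous_movement M" "M 1 = \<alpha>" "swept M A \<in> sets lebesgue"
        "emeasure lebesgue (swept M A) < ennreal \<epsilon>"
      using mv[OF \<epsilon>] by blast
    \<comment> \<open>Evaluating at the points 0 and 1 recovers the coefficients of
      \<open>M t\<close> by a formula, so continuity of the movement passes to them.\<close>
    define U where "U t = M t 1 - M t 0" for t
    define C where "C t = M t 0" for t
    have MUC: "M t x = U t * x + C t" "norm (U t) = 1" if "t \<in> {0..1}" for t x
    proof -
      have "rigid_motion (M t)" using M(1) that by (simp add: continuous_movement_def)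
      then obtain u' c' where "norm u' = 1" "M t = (\<lambda>x. u' * x + c')"
        unfolding rigid_motion_def by blast
      then show "M t x = U t * x + C t" "norm (U t) = 1" by (simp_all add: U_def C_def)
    qed
    have contM: "continuous_on ({0..1} \<times> UNIV) (\<lambda>(t, x). M t x)" and M0: "M 0 = id"
      using M(1) by (auto simp: continuous_movement_def)
    have cont': "continuous_on {0..1} (\<lambda>t. M t x)" for x
    proof -
      have "continuous_on {0..1} (\<lambda>t. (t, x))" by (intro continuous_intros)
      from continuous_on_compose2[OF contM this] show ?thesis by auto
    qed
    have contU: "continuous_on {0..1} U" and contC: "continuous_on {0..1} C"
      unfolding U_def C_def by (intro continuous_intros cont')+
    have contD: "continuous_on {0..1} (\<lambda>t. norm (U t - 1) + norm (C t))"
      by (intro continuous_intros contU contC)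
    obtain T where T: "T \<in> {0..1}" "norm (U T - 1) + norm (C T) = \<delta>"
        "\<And>t. t \<in> {0..T} \<Longrightarrow> norm (U t - 1) + norm (C t) \<le> \<delta>"
      by (rule first_hitting_time[OF contD, of \<delta>])
        (use \<delta> in \<open>auto simp: U_def C_def M0 M(2) \<alpha>_eq \<delta>0_def\<close>)
    \<comment> \<open>For \<open>norm U = 1\<close> the inverse of
      \<open>x \<mapsto> U * x + C\<close> is \<open>p \<mapsto> cnj U * (p - C)\<close>. The factor
      \<open>T\<close> rescales the stopped time interval \<open>{0..T}\<close> to
      \<open>{0..1}\<close>.\<close>
    define v where "v t = cnj (U (T * t))" for t
    define d where "d t = - v t * C (T * t)" for t
    have Tt: "T * t \<in> {0..1}" "T * t \<in> {0..T}" if "t \<in> {0..1}" for t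
      using T(1) that mult_left_le[of t T] mult_le_one[of T t] by auto
    have nv: "norm (v t) = 1" "norm (d t) = norm (C (T * t))" "norm (v t - 1) = norm (U (T * t) - 1)"
      if "t \<in> {0..1}" for t
    proof -
      show 1: "norm (v t) = 1" using MUC Tt that by (simp add: v_def)
      then show "norm (d t) = norm (C (T * t))" by (simp add: d_def norm_mult)
      show "norm (v t - 1) = norm (U (T * t) - 1)"
        by (metis complex_cnj_diff complex_cnj_one complex_mod_cnj v_def)
    qed
    have "(\<lambda>t. T * t) ` {0..1} \<subseteq> {0..1}" using Tt by blast
    then have contv: "continuous_on {0..1} v" "continuous_on {0..1} d"
      unfolding d_def v_def
      by (auto intro!: continuous_intros continuous_on_compose2[OF contU] continuous_on_compose2[OF contC])
    have "swept M A \<in> lmeasurable"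
      using M(3) order.strict_trans[OF M(4) ennreal_less_top] by (simp add: fmeasurable_def)
    moreover from this have "measure lebesgue (swept M A) < \<epsilon>"
      using M(4) \<epsilon> by (simp add: emeasure_eq_measure2 ennreal_less_iff)
    ultimately obtain S where S: "open S" "swept M A \<subseteq> S" "S \<in> lmeasurable" "measure lebesgue S < \<epsilon>"
      by (rule lmeasurable_open_superset)
    have "v t * p + d t \<notin> A" if "p \<notin> S" "t \<in> {0..1}" for p t
    proof
      assume A: "v t * p + d t \<in> A"
      have "U (T * t) * cnj (U (T * t)) = 1"
        using MUC(2)[OF Tt(1)[OF that(2)]] by (metis complex_norm_square of_real_1 one_power2)
      then have "M (T * t) (v t * p + d t) = p"
        using MUC(1)[OF Tt(1)[OF that(2)]] by (simp add: d_def v_def algebra_simps flip: mult.assoc)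
      then have "p \<in> swept M A"
        unfolding swept_def using A Tt that(2) by force
      then show False using S that by blast
    qed
    moreover have "v 0 = 1" "d 0 = 0" by (simp_all add: v_def d_def U_def C_def M0)
    moreover have "norm (v 1 - 1) + norm (d 1) = \<delta>" using nv[of 1] T(2) by simp
    moreover have "norm (v t - 1) + norm (d t) \<le> \<delta>" if "t \<in> {0..1}" for t
      using nv[OF that] T(3)[OF Tt(2)[OF that]] by simp
    ultimately have "small_move A \<delta> \<epsilon> v d"
      unfolding small_move_def using S(1,3,4) contv nv(1) by blast
    then show "\<exists>v d. small_move A \<delta> \<epsilon> v d" by blast
  qed
qed

text \<open>The norms of the rescaled displacements \<open>a n\<close> and \<open>b n\<close> add up
  to 1, so a subsequence converges and its limit is not zero. The rotational part of the limit is
  tangent to the unit circle at 1, hence purely imaginary, which yields the real rate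
  \<omega>.\<close>

lemma kakeya_generator:
  assumes "kakeya_property A"
  obtains \<omega> :: real and \<tau> :: complex where "\<omega> \<noteq> 0 \<or> \<tau> \<noteq> 0"
    "\<forall>e>0. \<exists>\<delta> v d. 0 < \<delta> \<and> \<delta> < e \<and> small_move A \<delta> (\<delta>\<^sup>2) v d \<and>
        norm (v 1 - 1 - \<delta> * (\<i> * \<omega>)) \<le> e * \<delta> \<and> norm (d 1 - \<delta> * \<tau>) \<le> e * \<delta>"
proof -
  obtain \<delta>0 where \<delta>0: "\<delta>0 > 0"
    and mv: "\<And>\<delta> \<epsilon>. 0 < \<delta> \<Longrightarrow> \<delta> \<le> \<delta>0 \<Longrightarrow> 0 < \<epsilon> \<Longrightarrow> \<exists>v d. small_move A \<delta> \<epsilon> v d"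
    using kakeya_small_moves[OF assms] by blast
  define \<delta> where "\<delta> n = \<delta>0 / real (Suc n)" for n
  have \<delta>: "0 < \<delta> n" "\<delta> n \<le> \<delta>0" for n
    using \<delta>0 by (auto simp: \<delta>_def field_simps)
  have \<delta>lim: "\<delta> \<longlonglongrightarrow> 0"
    unfolding \<delta>_def using LIMSEQ_Suc[OF lim_const_over_n[of \<delta>0]] by simp
  have "\<exists>v d. small_move A (\<delta> n) ((\<delta> n)\<^sup>2) v d" for n
    using mv[of "\<delta> n" "(\<delta> n)\<^sup>2"] \<delta>[of n] by simp
  then obtain v d where vd: "\<And>n. small_move A (\<delta> n) ((\<delta> n)\<^sup>2) (v n) (d n)" by metis
  define a where "a n = (v n 1 - 1) / \<delta> n" for n
  define b where "b n = d n 1 / \<delta> n" for n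
  have sum: "norm (v n 1 - 1) + norm (d n 1) = \<delta> n" "norm (v n 1) = 1" for n
    using vd[of n] by (auto simp: small_move_def)
  have ab: "norm (a n) + norm (b n) = 1" for n
    using \<delta>[of n] sum(1)[of n] by (simp add: a_def b_def norm_divide flip: add_divide_distrib)
  have "(a n, b n) \<in> cball 0 1 \<times> cball 0 1" for n
    using ab[of n] by (simp, smt (verit) norm_ge_zero)
  moreover have "compact (cball (0::complex) 1 \<times> cball (0::complex) 1)"
    by (intro compact_Times compact_cball)
  ultimately obtain l r where r: "strict_mono (r :: nat \<Rightarrow> nat)" "((\<lambda>n. (a n, b n)) \<circ> r) \<longlonglongrightarrow> l"
    using seq_compactE[OF compact_imp_seq_compact, of "cball 0 1 \<times> cball 0 1" "\<lambda>n. (a n, b n)"]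
    by metis
  obtain a' \<tau> where l: "l = (a', \<tau>)" by (cases l)
  have la: "(\<lambda>n. a (r n)) \<longlonglongrightarrow> a'" and lb: "(\<lambda>n. b (r n)) \<longlonglongrightarrow> \<tau>"
    using tendsto_fst[OF r(2)] tendsto_snd[OF r(2)] by (auto simp: l o_def)
  have ld: "(\<lambda>n. \<delta> (r n)) \<longlonglongrightarrow> 0"
    using LIMSEQ_subseq_LIMSEQ[OF \<delta>lim r(1)] by (simp add: o_def)
  have "(\<lambda>n. norm (a (r n)) + norm (b (r n))) \<longlonglongrightarrow> norm a' + norm \<tau>"
    by (intro tendsto_intros la lb)
  then have "(\<lambda>n. 1 :: real) \<longlonglongrightarrow> norm a' + norm \<tau>"
    by (simp only: ab)
  then have one: "norm a' + norm \<tau> = 1"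
    using LIMSEQ_unique tendsto_const by blast
  \<comment> \<open>A complex number v of modulus 1 satisfies |v - 1|^2 = -2 Re (v - 1). The real
    part is thus of second order and still vanishes after division by
    \<open>\<delta> n\<close>.\<close>
  have "\<bar>Re (a n)\<bar> \<le> \<delta> n" for n
  proof -
    have "(Re (v n 1))\<^sup>2 + (Im (v n 1))\<^sup>2 = 1"
      using sum(2)[of n] by (simp add: cmod_def)
    then have "(norm (v n 1 - 1))\<^sup>2 = - 2 * Re (v n 1 - 1)"
      unfolding cmod_power2 by (simp add: power2_eq_square algebra_simps)
    moreover have "norm (v n 1 - 1) \<le> \<delta> n" using sum(1)[of n] by (smt (verit) norm_ge_zero)
    then have "(norm (v n 1 - 1))\<^sup>2 \<le> (\<delta> n)\<^sup>2" by (simp add: power_mono)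
    ultimately have "\<bar>Re (v n 1 - 1)\<bar> \<le> (\<delta> n)\<^sup>2" by (smt (verit) zero_le_power2)
    then show ?thesis using \<delta>[of n]
      by (simp add: a_def Re_divide_of_real power2_eq_square field_simps)
  qed
  then have "(\<lambda>n. Re (a (r n))) \<longlonglongrightarrow> 0"
    by (intro Lim_null_comparison[OF _ ld]) auto
  moreover have "(\<lambda>n. Re (a (r n))) \<longlonglongrightarrow> Re a'" by (intro tendsto_intros la)
  ultimately have Re0: "Re a' = 0" using LIMSEQ_unique by blast
  have a'_eq: "a' = \<i> * Im a'" using Re0 by (simp add: complex_eq_iff)
  show ?thesis
  proof (rule that[of "Im a'" \<tau>])
    show "Im a' \<noteq> 0 \<or> \<tau> \<noteq> 0" using one a'_eq by auto
    show "\<forall>e>0. \<exists>\<delta> v d. 0 < \<delta> \<and> \<delta> < e \<and> small_move A \<delta> (\<delta>\<^sup>2) v d \<and>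
        norm (v 1 - 1 - \<delta> * (\<i> * Im a')) \<le> e * \<delta> \<and> norm (d 1 - \<delta> * \<tau>) \<le> e * \<delta>"
    proof (intro allI impI)
      fix e :: real assume e: "e > 0"
      have "\<forall>\<^sub>F n in sequentially. dist (\<delta> (r n)) 0 < e \<and> dist (a (r n)) a' < e \<and> dist (b (r n)) \<tau> < e"
        using tendstoD[OF ld e] tendstoD[OF la e] tendstoD[OF lb e] by (simp add: eventually_conj_iff)
      then obtain n where n: "dist (\<delta> (r n)) 0 < e" "dist (a (r n)) a' < e" "dist (b (r n)) \<tau> < e"
        using eventually_happens' sequentially_bot by blast
      let ?n = "r n"
      have va: "v ?n 1 - 1 = \<delta> ?n * a ?n" and db: "d ?n 1 = \<delta> ?n * b ?n"
        using \<delta>(1)[of ?n] by (simp_all add: a_def b_def)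
      have "norm (\<delta> ?n * a ?n - \<delta> ?n * a') \<le> e * \<delta> ?n" "norm (\<delta> ?n * b ?n - \<delta> ?n * \<tau>) \<le> e * \<delta> ?n"
        using n(2,3) \<delta>(1)[of ?n] unfolding dist_norm right_diff_distrib[symmetric] norm_mult norm_of_real
        by (simp_all add: mult.commute[of e] less_imp_le)
      then have "norm (v ?n 1 - 1 - \<delta> ?n * (\<i> * Im a')) \<le> e * \<delta> ?n" "norm (d ?n 1 - \<delta> ?n * \<tau>) \<le> e * \<delta> ?n"
        unfolding va db a'_eq[symmetric] .
      then show "\<exists>\<delta> v d. 0 < \<delta> \<and> \<delta> < e \<and> small_move A \<delta> (\<delta>\<^sup>2) v d \<and>
          norm (v 1 - 1 - \<delta> * (\<i> * Im a')) \<le> e * \<delta> \<and> norm (d 1 - \<delta> * \<tau>) \<le> e * \<delta>"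
        using \<delta>(1)[of ?n] n(1) vd[of ?n]
        by (intro exI[of _ "\<delta> ?n"] exI[of _ "v ?n"] exI[of _ "d ?n"]) simp
    qed
  qed
qed

section \<open>Iterating the inverse movement\<close>

text \<open>Rotations are treated in \<open>real^2\<close>, as orthogonal transformations. The
  linear isometry \<open>T\<close> from the complex plane to \<open>real^2\<close> preserves
  Lebesgue measure because it matches boxes with boxes of the same area. The translation is removed
  beforehand, in the complex plane.\<close>

lemma open_motion_vimage_measure:
  fixes S :: "complex set"
  assumes "open S" "S \<in> lmeasurable" and u: "norm u = 1"
  shows "(\<lambda>z. u * z + c) -` S \<in> lmeasurable"
    and "measure lebesgue ((\<lambda>z. u * z + c) -` S) = measure lebesgue S"
proof -
  define T :: "complex \<Rightarrow> real^2" where "T z = (\<chi> i. if i = 1 then Re z else Im z)" for z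
  define T' :: "real^2 \<Rightarrow> complex" where "T' x = Complex (x $ 1) (x $ 2)" for x
  have inv [simp]: "T' (T z) = z" "T (T' x) = x" for z x
    by (auto simp: T_def T'_def vec_eq_iff forall_2)
  have lin: "linear T" "linear T'"
    by (auto simp: T_def T'_def linear_iff vec_eq_iff complex_eq_iff)
  have cont: "continuous_on UNIV T" "continuous_on UNIV T'"
    using lin by (simp_all add: linear_continuous_on linear_linear)
  have normT': "norm (T' x) = norm x" for x
    by (simp add: T'_def norm_vec_def L2_set_def sum_2 cmod_def)
  have normT: "norm (T x) = norm x" for x
    by (metis inv(1) normT')
  have d: "distr lborel borel T = lborel"
  proof (rule lborel_eqI[symmetric])
    fix l r :: "real^2" assume le: "\<And>b. b \<in> Basis \<Longrightarrow> l \<bullet> b \<le> r \<bullet> b"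
    have le': "l $ i \<le> r $ i" for i
      using le[of "axis i 1"] by (simp add: inner_axis axis_in_Basis_iff)
    have "T -` box l r = box (T' l) (T' r)"
      by (auto simp: T_def T'_def mem_box_cart in_box_complex_iff forall_2)
    moreover have "T \<in> borel_measurable lborel"
      using borel_measurable_continuous_onI[OF cont(1)] by simp
    ultimately have "emeasure (distr lborel borel T) (box l r) = emeasure lborel (box (T' l) (T' r))"
      by (simp add: emeasure_distr)
    also have "\<dots> = (\<Prod>b\<in>Basis. (T' r - T' l) \<bullet> b)"
      by (rule emeasure_lborel_box) (use le' in \<open>auto simp: Basis_complex_def T'_def\<close>)
    also have "(\<Prod>b\<in>Basis. (T' r - T' l) \<bullet> b) = (\<Prod>b\<in>Basis. (r - l) \<bullet> b)"
      by (simp add: Basis_complex_def T'_def Basis_vec_def axis_eq_axis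
          UNIV_2 inner_axis)
    finally show "emeasure (distr lborel borel T) (box l r) = (\<Prod>b\<in>Basis. (r - l) \<bullet> b)" .
  qed simp
  have em: "emeasure lborel (T' -` B) = emeasure lborel B" if "open B" for B
  proof -
    have "T \<in> borel_measurable lborel"
      using borel_measurable_continuous_onI[OF cont(1)] by simp
    moreover have "T -` (T' -` B) = B" by auto
    moreover have "open (T' -` B)"
      using cont(2) that continuous_on_open_vimage[of UNIV T'] by (simp add: open_vimage)
    ultimately show ?thesis
      using emeasure_distr[of T lborel borel "T' -` B"] d by simp
  qed
  have "open ((\<lambda>z. u * z + c) -` S)"
    by (rule open_vimage[OF \<open>open S\<close>]) (intro continuous_intros)
  note op = this \<open>open S\<close>
  \<comment> \<open>The preimage of \<open>S\<close> is the translate of \<open>S\<close> by -c,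
    turned by the inverse rotation, which multiplies by \<open>cnj u\<close>; \<open>g\<close> is
    that rotation in the coordinates of \<open>real^2\<close>.\<close>
  define g where "g x = T (cnj u * T' x)" for x
  have uu: "cnj u * u = 1" "u * cnj u = 1"
    using u by (metis complex_norm_square mult.commute of_real_1 one_power2)+
  have lg: "linear g"
    unfolding g_def by (rule linearI) (use lin in \<open>simp_all add: linear_add linear_scale algebra_simps\<close>)
  have og: "orthogonal_transformation g"
    unfolding orthogonal_transformation using lg u by (auto simp: g_def normT normT' norm_mult)
  define S0 where "S0 = (\<lambda>s. s - c) ` S"
  have S0: "open S0" "S0 \<in> lmeasurable" "measure lebesgue S0 = measure lebesgue S"
    using assms measurable_translation_subtract[of S c] measure_translation_subtract[of c S] open_translation_subtract[of S c]
    by (auto simp: S0_def)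
  have eq: "T' -` ((\<lambda>z. u * z + c) -` S) = g ` (T' -` S0)"
  proof (intro set_eqI iffI)
    fix x assume x: "x \<in> T' -` (\<lambda>z. u * z + c) -` S"
    have "x = g (T (u * T' x))" using uu by (simp add: g_def flip: mult.assoc)
    moreover have "T (u * T' x) \<in> T' -` S0" using x by (force simp: S0_def)
    ultimately show "x \<in> g ` (T' -` S0)" by blast
  next
    fix x assume "x \<in> g ` (T' -` S0)"
    then show "x \<in> T' -` (\<lambda>z. u * z + c) -` S"
      using uu by (auto simp: g_def S0_def simp flip: mult.assoc)
  qed
  have op': "open (T' -` S0)" "open (g ` (T' -` S0))"
    using op S0 cont(2) by (auto simp: open_vimage simp flip: eq)
  have fin: "emeasure lborel (T' -` S0) = emeasure lborel S0" using em S0 by simp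
  have meas: "T' -` S0 \<in> lmeasurable"
    using fin S0 op' by (simp add: fmeasurable_def)
  have "emeasure lborel ((\<lambda>z. u * z + c) -` S) = emeasure lborel (g ` (T' -` S0))"
    using em[OF op(1)] eq by simp
  also have "\<dots> = emeasure lborel (T' -` S0)"
    using measure_orthogonal_image[OF og meas] measurable_orthogonal_image[OF og meas] meas op'
    by (simp add: fmeasurable_def emeasure_eq_ennreal_measure less_top)
  also have "\<dots> = emeasure lebesgue S0" using fin S0(1) by simp
  also have "\<dots> = emeasure lebesgue S"
    by (simp add: emeasure_eq_measure2 S0 assms)
  also have "\<dots> = emeasure lborel S" using assms(1) by simp
  finally have e: "emeasure lborel ((\<lambda>z. u * z + c) -` S) = emeasure lborel S" .
  show "(\<lambda>z. u * z + c) -` S \<in> lmeasurable"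
    using e assms op by (simp add: fmeasurable_def)
  show "measure lebesgue ((\<lambda>z. u * z + c) -` S) = measure lebesgue S"
    using e assms op by (simp add: measure_def)
qed

text \<open>The axioms describe a one-parameter group of rigid motions
  \<open>z \<mapsto> a s * z + b s\<close> with generator
  \<open>z \<mapsto> \<i> * \<omega> * z + \<tau>\<close>. Rotations about a fixed centre and
  translations are both instances, so the Euler scheme is carried out once for both.\<close>

locale screw_flow =
  fixes a b :: "real \<Rightarrow> complex" and \<omega> :: real and \<tau> :: complex
  assumes norm_a: "norm (a s) = 1"
    and a_add: "a (s + t) = a s * a t"
    and b_add: "b (s + t) = a s * b t + b s"
    and cont_a: "continuous_on UNIV a"
    and cont_b: "continuous_on UNIV b"
    and deriv_a: "(a has_vector_derivative \<i> * \<omega>) (at 0)"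
    and deriv_b: "(b has_vector_derivative \<tau>) (at 0)"
begin

definition flow :: "real \<Rightarrow> complex \<Rightarrow> complex" where
  "flow s z = a s * z + b s"

lemma a_0 [simp]: "a 0 = 1"
  using a_add[of 0 0] norm_a[of 0] by auto

lemma b_0 [simp]: "b 0 = 0"
  using b_add[of 0 0] by simp

lemma flow_0 [simp]: "flow 0 z = z"
  by (simp add: flow_def)

lemma flow_add: "flow (s + t) z = flow s (flow t z)"
  by (simp add: flow_def a_add b_add algebra_simps)

lemma dist_flow [simp]: "dist (flow s z) (flow s w) = dist z w"
proof -
  have "flow s z - flow s w = a s * (z - w)" by (simp add: flow_def algebra_simps)
  then show ?thesis by (simp add: dist_norm norm_mult norm_a)
qed

lemma continuous_flow: "continuous_on UNIV (\<lambda>(s, z). flow s z)"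
  unfolding flow_def split_def
  by (intro continuous_intros continuous_on_compose2[OF cont_a] continuous_on_compose2[OF cont_b]) auto

lemma flow_bounded:
  assumes "compact B"
  obtains R where "R > 0" "\<And>\<sigma> z. \<sigma> \<in> {0..s} \<Longrightarrow> z \<in> B \<Longrightarrow> norm (flow \<sigma> z) \<le> R"
proof -
  have "compact ((\<lambda>(s, z). flow s z) ` ({0..s} \<times> B))"
    by (intro compact_continuous_image continuous_on_subset[OF continuous_flow] compact_Times assms) auto
  then obtain R where "R > 0" "\<forall>x\<in>(\<lambda>(s, z). flow s z) ` ({0..s} \<times> B). norm x \<le> R"
    using bounded_pos compact_imp_bounded by blast
  then show ?thesis by (intro that[of R]) auto
qed

lemma eventually_small_derivative:
  fixes f :: "real \<Rightarrow> complex"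
  assumes "(f has_vector_derivative D) (at 0)" "e > 0"
  shows "\<forall>\<^sub>F \<delta> in at_right 0. norm (f \<delta> - f 0 - \<delta> * D) \<le> e * \<delta>"
proof -
  obtain r where r: "r > 0" "\<And>y. norm y < r \<Longrightarrow> norm (f y - f 0 - y *\<^sub>R D) \<le> e * norm y"
    using assms unfolding has_vector_derivative_def has_derivative_at_alt by force
  show ?thesis
    unfolding eventually_at_right_field
  proof (intro exI[of _ r] conjI allI impI)
    fix y :: real assume "0 < y" "y < r"
    then show "norm (f y - f 0 - y * D) \<le> e * y"
      using r(2)[of y] by (simp add: scaleR_conv_of_real)
  qed (rule r)
qed

text \<open>Iterating a small inverse motion about \<open>s / \<delta>\<close> times approximates the flow up to time
  \<open>s\<close> (an Euler scheme); a starting point outside a set of measure at most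
  \<open>(s / \<delta> + 1) * \<delta>\<^sup>2\<close> is never carried into \<open>A\<close> on the way.\<close>

lemma flow_path_avoiding:
  assumes gen: "\<forall>e>0. \<exists>\<delta> v d. 0 < \<delta> \<and> \<delta> < e \<and> small_move A \<delta> (\<delta>\<^sup>2) v d \<and>
        norm (v 1 - 1 - \<delta> * (\<i> * \<omega>)) \<le> e * \<delta> \<and> norm (d 1 - \<delta> * \<tau>) \<le> e * \<delta>"
    and P: "open P" "P \<noteq> {}" and s: "s \<ge> 0" and \<eta>: "\<eta> > 0"
  obtains p q where "p \<in> P" "dist q (flow s p) < \<eta>"
    "path_component ({x. \<exists>\<sigma>\<in>{0..s}. dist x (flow \<sigma> p) < \<eta>} - A) p q"
proof -
  obtain p0 r where r: "r > 0" "cball p0 r \<subseteq> P"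
    using P open_contains_cball by blast
  define B where "B = cball p0 r"
  obtain R where R: "R > 0" "\<And>\<sigma> z. \<sigma> \<in> {0..s} \<Longrightarrow> z \<in> B \<Longrightarrow> norm (flow \<sigma> z) \<le> R"
    using flow_bounded[of B s] by (auto simp: B_def)
  \<comment> \<open>Each step will err by at most 2 e \<delta> (R + 1), and at most s / \<delta>
    steps are made; this \<open>e\<close> keeps the accumulated error at most \<eta> / 4.\<close>
  define e where "e = \<eta> / (8 * (s + 1) * (R + 1))"
  have e: "e > 0" using s \<eta> R by (simp add: e_def)
  have mB: "measure lebesgue B > 0"
    using r by (simp add: B_def content_cball_pos)
  have cont0: "(a \<longlongrightarrow> 1) (at 0)" "(b \<longlongrightarrow> 0) (at 0)"
    using cont_a cont_b a_0 b_0 unfolding continuous_on_eq_continuous_at[OF open_UNIV] isCont_def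
    by (metis UNIV_I)+
  have "\<forall>\<^sub>F \<delta> in at_right (0::real). norm (a \<delta> - a 0 - \<delta> * (\<i> * \<omega>)) \<le> e * \<delta> \<and>
          norm (b \<delta> - b 0 - \<delta> * \<tau>) \<le> e * \<delta> \<and> \<delta> < 1"
    using eventually_small_derivative[OF deriv_a e] eventually_small_derivative[OF deriv_b e]
      eventually_at_right_less[of 0] 
    by (auto simp: eventually_conj_iff eventually_at_right_field intro: exI[of _ 1])
  then obtain \<delta>1 where \<delta>1: "\<delta>1 > 0"
    "\<And>\<delta>. 0 < \<delta> \<Longrightarrow> \<delta> < \<delta>1 \<Longrightarrow> norm (a \<delta> - 1 - \<delta> * (\<i> * \<omega>)) \<le> e * \<delta> \<and> norm (b \<delta> - \<delta> * \<tau>) \<le> e * \<delta> \<and> \<delta> < 1"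
    by (auto simp: eventually_at_right_field)
  have "\<forall>\<^sub>F \<sigma> in at (0::real). dist (a \<sigma>) 1 < \<eta> / (4 * (R + 1)) \<and> dist (b \<sigma>) 0 < \<eta> / (4 * (R + 1))"
    using \<eta> R by (intro eventually_conj tendstoD cont0) auto
  then obtain \<delta>2 where \<delta>2: "\<delta>2 > 0" "\<And>\<sigma>. \<sigma> \<noteq> 0 \<Longrightarrow> \<bar>\<sigma>\<bar> < \<delta>2 \<Longrightarrow>
      dist (a \<sigma>) 1 < \<eta> / (4 * (R + 1)) \<and> dist (b \<sigma>) 0 < \<eta> / (4 * (R + 1))"
    by (auto simp: eventually_at)
  \<comment> \<open>The first three entries control the error of one step and the leftover time at
    the end. The fourth confines the excursion within one step to less than \<eta> / 4, and the
    fifth makes the excluded set smaller than \<open>B\<close>.\<close>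
  define e' where "e' = Min {e, \<delta>1, \<delta>2, \<eta> / (4 * (R + \<eta> + 1)), measure lebesgue B / (s + 1)}"
  have e': "e' > 0" using e \<delta>1 \<delta>2 R \<eta> s mB by (auto simp: e'_def)
  have e'_le: "e' \<le> e" "e' \<le> \<delta>1" "e' \<le> \<delta>2" "e' \<le> \<eta> / (4 * (R + \<eta> + 1))" "e' \<le> measure lebesgue B / (s + 1)"
    unfolding e'_def by (rule Min_le; simp)+
  obtain \<delta> v d where \<delta>: "0 < \<delta>" "\<delta> < e'" and sm: "small_move A \<delta> (\<delta>\<^sup>2) v d"
    and v1: "norm (v 1 - 1 - \<delta> * (\<i> * \<omega>)) \<le> e' * \<delta>" and d1: "norm (d 1 - \<delta> * \<tau>) \<le> e' * \<delta>"
    using gen e' by blast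
  have e'\<delta>: "e' * \<delta> \<le> e * \<delta>" using e'_le \<delta> by simp
  have a\<delta>: "norm (a \<delta> - 1 - \<delta> * (\<i> * \<omega>)) \<le> e * \<delta>" "norm (b \<delta> - \<delta> * \<tau>) \<le> e * \<delta>" "\<delta> < 1"
    using \<delta>1(2)[of \<delta>] \<delta> e'_le by auto
  have va: "norm (v 1 - a \<delta>) \<le> 2 * e * \<delta>"
    using norm_triangle_ineq4[of "v 1 - 1 - \<delta> * (\<i> * \<omega>)" "a \<delta> - 1 - \<delta> * (\<i> * \<omega>)"] v1 a\<delta> e'\<delta> by simp
  have db: "norm (d 1 - b \<delta>) \<le> 2 * e * \<delta>"
    using norm_triangle_ineq4[of "d 1 - \<delta> * \<tau>" "b \<delta> - \<delta> * \<tau>"] d1 a\<delta> e'\<delta> by simp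
  obtain S where S: "open S" "S \<in> lmeasurable" "measure lebesgue S < \<delta>\<^sup>2"
    "\<And>p t. p \<notin> S \<Longrightarrow> t \<in> {0..1} \<Longrightarrow> v t * p + d t \<notin> A"
    using sm unfolding small_move_def by blast
  have vd: "continuous_on {0..1} v" "continuous_on {0..1} d" "v 0 = 1" "d 0 = 0"
    "\<And>t. t \<in> {0..1} \<Longrightarrow> norm (v t) = 1" "\<And>t. t \<in> {0..1} \<Longrightarrow> norm (v t - 1) + norm (d t) \<le> \<delta>"
    using sm unfolding small_move_def by blast+
  define \<alpha> where "\<alpha> z = v 1 * z + d 1" for z
  have \<alpha>: "\<alpha> z = v 1 * z + d 1" for z by (simp add: \<alpha>_def)
  \<comment> \<open>What counts is the linear part of the iterate: it has modulus 1, so the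
    preimages of \<open>S\<close> have the measure of \<open>S\<close>.\<close>
  have pow: "\<exists>c. \<forall>z. (\<alpha> ^^ j) z = (v 1) ^ j * z + c" for j
  proof (induction j)
    case (Suc j)
    then obtain c where c: "\<And>z. (\<alpha> ^^ j) z = (v 1) ^ j * z + c" by blast
    have "(\<alpha> ^^ Suc j) z = (v 1) ^ Suc j * z + (v 1 * c + d 1)" for z
    proof -
      have "(\<alpha> ^^ Suc j) z = \<alpha> ((\<alpha> ^^ j) z)" by simp
      also have "\<dots> = v 1 * (\<alpha> ^^ j) z + d 1" by (rule \<alpha>)
      finally show ?thesis by (simp add: c algebra_simps)
    qed
    then show ?case by blast
  qed (auto intro: exI[of _ 0])
  have step: "dist (\<alpha> z) (flow \<delta> z) \<le> 2 * e * \<delta> * (norm z + 1)" for z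
  proof -
    have "\<alpha> z - flow \<delta> z = (v 1 - a \<delta>) * z + (d 1 - b \<delta>)"
      by (simp add: \<alpha>[of z] flow_def algebra_simps)
    then have "dist (\<alpha> z) (flow \<delta> z) \<le> norm (v 1 - a \<delta>) * norm z + norm (d 1 - b \<delta>)"
      by (metis dist_norm norm_mult norm_triangle_ineq)
    also have "\<dots> \<le> 2 * e * \<delta> * norm z + 2 * e * \<delta>"
      by (intro add_mono mult_right_mono va db) auto
    finally show ?thesis by (simp add: algebra_simps)
  qed
  define k where "k = nat \<lfloor>s / \<delta>\<rfloor>"
  have k: "real k * \<delta> \<le> s" "s < real k * \<delta> + \<delta>"
  proof -
    have "real k = real_of_int \<lfloor>s / \<delta>\<rfloor>" using s \<delta> by (simp add: k_def)
    then have "real k \<le> s / \<delta>" "s / \<delta> < real k + 1" by linarith+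
    then show "real k * \<delta> \<le> s" "s < real k * \<delta> + \<delta>" using \<delta>(1) by (simp_all add: field_simps)
  qed
  \<comment> \<open>Starting points for which one of the iterates 0 to k enters \<open>S\<close>.
    There are k + 1 preimages of measure at most \<delta>^2, in total at most (s + 1) \<delta>
    because \<open>\<delta> < 1\<close>.\<close>
  define T where "T = (\<Union>j\<in>{..k}. (\<alpha> ^^ j) -` S)"
  have mj: "(\<alpha> ^^ j) -` S \<in> lmeasurable" "measure lebesgue ((\<alpha> ^^ j) -` S) \<le> \<delta>\<^sup>2" for j
  proof -
    obtain c where "\<And>z. (\<alpha> ^^ j) z = (v 1) ^ j * z + c" using pow by blast
    then have eq: "(\<alpha> ^^ j) = (\<lambda>z. (v 1) ^ j * z + c)" by blast
    have n: "norm ((v 1) ^ j) = 1" using vd(5)[of 1] by (simp add: norm_power)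
    show "(\<alpha> ^^ j) -` S \<in> lmeasurable" "measure lebesgue ((\<alpha> ^^ j) -` S) \<le> \<delta>\<^sup>2"
      using open_motion_vimage_measure[OF S(1,2) n, of c] S(3) by (simp_all add: eq)
  qed
  have "measure lebesgue T \<le> (\<Sum>j\<in>{..k}. measure lebesgue ((\<alpha> ^^ j) -` S))"
    unfolding T_def using mj(1) by (intro measure_UNION_le) auto
  also have "\<dots> \<le> (\<Sum>j\<in>{..k}. \<delta>\<^sup>2)" by (intro sum_mono mj)
  also have "\<dots> = (real k * \<delta> + \<delta>) * \<delta>" by (simp add: power2_eq_square algebra_simps)
  also have "\<dots> \<le> (s + 1) * \<delta>" using k a\<delta>(3) \<delta>(1) by (intro mult_right_mono) auto
  also have "\<dots> < (s + 1) * e'" using \<delta>(2) s by (intro mult_strict_left_mono) auto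
  also have "\<dots> \<le> (s + 1) * (measure lebesgue B / (s + 1))" using e'_le(5) s by (intro mult_left_mono) auto
  also have "\<dots> = measure lebesgue B" using s by (intro nonzero_mult_div_cancel_left[THEN trans[OF times_divide_eq_right]]) auto
  finally have "measure lebesgue T < measure lebesgue B" .
  moreover have "T \<in> lmeasurable" unfolding T_def using mj(1) by (intro fmeasurable.finite_UN) auto
  moreover have "B \<in> sets lebesgue" by (simp add: B_def)
  ultimately have "\<not> B \<subseteq> T"
    using measure_mono_fmeasurable[of B T lebesgue] by linarith
  then obtain p where p: "p \<in> B" "p \<notin> T" by blast
  have bound: "2 * e * (R + 1) * s \<le> \<eta> / 4"
  proof -
    have "2 * e * (R + 1) * s = \<eta> / 4 * (s / (s + 1))"
      using R s unfolding e_def by (simp add: divide_simps) 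
    also have "\<dots> \<le> \<eta> / 4 * 1" using \<eta> s by (intro mult_left_mono) (auto simp: field_simps)
    finally show ?thesis by simp
  qed
  \<comment> \<open>\<open>\<alpha>\<close> is an isometry, so old errors are passed on without
    growth and only a new one is added. The new one is measured at the flow point, whose norm is at
    most \<open>R\<close>.\<close>
  have err: "dist ((\<alpha> ^^ j) p) (flow (j * \<delta>) p) \<le> 2 * e * (R + 1) * (j * \<delta>)" if "j \<le> k" for j
    using that
  proof (induction j)
    case (Suc j)
    have j: "real j * \<delta> \<in> {0..s}"
      using Suc.prems k \<delta> by (auto intro: order_trans[OF mult_right_mono[of "real j" "real k"]])
    have "flow (Suc j * \<delta>) p = flow \<delta> (flow (j * \<delta>) p)"
      by (simp add: algebra_simps flip: flow_add)
    moreover have "dist (\<alpha> ((\<alpha> ^^ j) p)) (\<alpha> (flow (j * \<delta>) p)) = dist ((\<alpha> ^^ j) p) (flow (j * \<delta>) p)"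
    proof -
      have "\<alpha> x - \<alpha> y = v 1 * (x - y)" for x y by (simp add: \<alpha> algebra_simps)
      then show ?thesis using vd(5)[of 1] by (simp add: dist_norm norm_mult)
    qed
    moreover have "dist (\<alpha> (flow (j * \<delta>) p)) (flow \<delta> (flow (j * \<delta>) p)) \<le> 2 * e * \<delta> * (R + 1)"
      by (rule order_trans[OF step mult_left_mono]) (use R(2)[OF j p(1)] e \<delta>(1) in auto)
    ultimately have "dist ((\<alpha> ^^ Suc j) p) (flow (Suc j * \<delta>) p)
        \<le> 2 * e * (R + 1) * (j * \<delta>) + 2 * e * \<delta> * (R + 1)"
      using Suc dist_triangle[of "\<alpha> ((\<alpha> ^^ j) p)" "flow \<delta> (flow (j * \<delta>) p)" "\<alpha> (flow (j * \<delta>) p)"]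
      by simp
    then show ?case by (simp add: algebra_simps)
  qed simp
  have err': "dist ((\<alpha> ^^ j) p) (flow (j * \<delta>) p) \<le> \<eta> / 4" and j\<delta>: "real j * \<delta> \<in> {0..s}" if "j \<le> k" for j
  proof -
    have "real j * \<delta> \<le> real k * \<delta>" using that \<delta>(1) by simp
    then have "real j * \<delta> \<le> s" using k(1) by linarith
    then show j: "real j * \<delta> \<in> {0..s}" using \<delta>(1) by simp
    have "2 * e * (R + 1) * (j * \<delta>) \<le> 2 * e * (R + 1) * s"
      using j e R by (intro mult_left_mono) auto
    then show "dist ((\<alpha> ^^ j) p) (flow (j * \<delta>) p) \<le> \<eta> / 4" using err[OF that] bound by linarith
  qed
  define U where "U = {x. \<exists>\<sigma>\<in>{0..s}. dist x (flow \<sigma> p) < \<eta>} - A"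
  \<comment> \<open>Between two iterates the motion is known only to avoid \<open>A\<close> and to
    obey the size bound of the small move; that already keeps the whole arc within \<eta> of a
    single flow point.\<close>
  have arc: "v t * (\<alpha> ^^ j) p + d t \<in> U" if "j \<le> k" "t \<in> {0..1}" for j t
  proof -
    let ?y = "(\<alpha> ^^ j) p"
    have "?y \<notin> S" using p(2) that(1) by (auto simp: T_def)
    then have notA: "v t * ?y + d t \<notin> A" using S(4) that by blast
    have "norm ?y \<le> dist ?y (flow (j * \<delta>) p) + norm (flow (j * \<delta>) p)"
      by (metis dist_norm norm_triangle_sub add.commute)
    then have ny: "norm ?y \<le> R + \<eta>" using err'[OF that(1)] R(2)[OF j\<delta>[OF that(1)] p(1)] \<eta> by linarith
    have "v t * ?y + d t - ?y = (v t - 1) * ?y + d t" by (simp add: algebra_simps)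
    then have "dist (v t * ?y + d t) ?y \<le> norm (v t - 1) * norm ?y + norm (d t)"
      by (metis dist_norm norm_mult norm_triangle_ineq)
    also have "\<dots> \<le> \<delta> * (R + \<eta>) + \<delta>"
      using vd(6)[OF that(2)] ny \<delta> norm_ge_zero[of "d t"] norm_ge_zero[of "v t - 1"]
      by (intro add_mono mult_mono) (linarith | simp)+
    also have "\<dots> = \<delta> * (R + \<eta> + 1)" by (simp add: algebra_simps)
    also have "\<dots> < e' * (R + \<eta> + 1)" using \<delta>(2) R \<eta> by (intro mult_strict_right_mono) auto
    also have "\<dots> \<le> \<eta> / 4" using e'_le(4) R \<eta> by (simp add: field_simps)
    finally have "dist (v t * ?y + d t) (flow (j * \<delta>) p) < \<eta>"
      using err'[OF that(1)] \<eta> dist_triangle[of "v t * ?y + d t" "flow (j * \<delta>) p" ?y] by linarith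
    then show ?thesis using notA j\<delta>[OF that(1)] by (auto simp: U_def)
  qed
  have "path_component U p ((\<alpha> ^^ j) p)" if "j \<le> k" for j
    using that
  proof (induction j)
    case 0
    then show ?case using arc[of 0 0] vd by (simp add: path_component_refl)
  next
    case (Suc j)
    have "path (\<lambda>t. v t * (\<alpha> ^^ j) p + d t)"
      unfolding path_def by (intro continuous_intros vd)
    then have "path_component U ((\<alpha> ^^ j) p) ((\<alpha> ^^ Suc j) p)"
      unfolding path_component_def using arc[of j] Suc.prems
      by (intro exI[of _ "\<lambda>t. v t * (\<alpha> ^^ j) p + d t"])
        (auto simp: path_image_def pathstart_def pathfinish_def vd \<alpha>[of "(\<alpha> ^^ j) p"])
    then show ?case using Suc path_component_trans by fastforce
  qed
  then have pc: "path_component U p ((\<alpha> ^^ k) p)" by simp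
  \<comment> \<open>The k steps fall short of time s by less than \<delta>; continuity of the flow
    at time 0 covers the remainder.\<close>
  have "dist (flow s p) (flow (k * \<delta>) p) = dist (flow (s - k * \<delta>) p) p"
    by (metis dist_flow flow_add add.commute diff_add_cancel)
  also have "\<dots> \<le> \<eta> / 4"
  proof (cases "s - k * \<delta> = 0")
    case False
    let ?\<sigma> = "s - k * \<delta>"
    have "\<bar>?\<sigma>\<bar> < \<delta>2" using k \<delta>(2) e'_le(3) by auto
    then have ab: "norm (a ?\<sigma> - 1) \<le> \<eta> / (4 * (R + 1))" "norm (b ?\<sigma>) \<le> \<eta> / (4 * (R + 1))"
      using \<delta>2(2)[OF False] by (auto simp: dist_norm)
    have "flow ?\<sigma> p - p = (a ?\<sigma> - 1) * p + b ?\<sigma>" by (simp add: flow_def algebra_simps)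
    then have "dist (flow ?\<sigma> p) p \<le> norm (a ?\<sigma> - 1) * norm p + norm (b ?\<sigma>)"
      by (metis dist_norm norm_mult norm_triangle_ineq)
    also have "\<dots> \<le> \<eta> / (4 * (R + 1)) * R + \<eta> / (4 * (R + 1))"
      using ab R(1) R(2)[of 0 p] s p(1) \<eta> by (intro add_mono mult_mono) auto
    also have "\<dots> = \<eta> / 4" using R by (simp add: divide_simps) (simp add: algebra_simps)
    finally show ?thesis .
  qed (use \<eta> in simp)
  finally have "dist ((\<alpha> ^^ k) p) (flow s p) < \<eta>"
    using err'[of k] \<eta> dist_triangle2[of "(\<alpha> ^^ k) p" "flow s p" "flow (k * \<delta>) p"] by simp
  then show ?thesis
    using that[OF _ _ pc[unfolded U_def]] p(1) r(2) by (auto simp: B_def)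
qed

end

section \<open>Separation and boundary bumping\<close>

lemma fashoda_complex:
  fixes f g :: "real \<Rightarrow> complex"
  assumes "path f" "path g"
    and box: "\<And>z. z \<in> path_image f \<union> path_image g \<Longrightarrow> Re z \<in> {x0..x1} \<and> Im z \<in> {y0..y1}"
    and "Re (pathstart f) = x0" "Re (pathfinish f) = x1"
    and "Im (pathstart g) = y0" "Im (pathfinish g) = y1"
  shows "path_image f \<inter> path_image g \<noteq> {}"
proof -
  define T :: "complex \<Rightarrow> real^2" where "T z = (\<chi> i. if i = 1 then Re z else Im z)" for z
  have inj: "z = w" if "T z = T w" for z w
    using that by (simp add: T_def vec_eq_iff complex_eq_iff forall_2)
  have "linear T" by (auto simp: T_def linear_iff vec_eq_iff)
  then have cont: "continuous_on S T" for S by (simp add: linear_continuous_on linear_linear)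
  have sub: "path_image (T \<circ> h) \<subseteq> cbox (T (Complex x0 y0)) (T (Complex x1 y1))"
    if "path_image h \<subseteq> path_image f \<union> path_image g" for h
    unfolding path_image_compose using that box
    by (auto simp: mem_box_cart T_def forall_2)
  obtain z where "z \<in> path_image (T \<circ> f)" "z \<in> path_image (T \<circ> g)"
  proof (rule fashoda[of "T \<circ> f" "T \<circ> g" "T (Complex x0 y0)" "T (Complex x1 y1)"])
    show "path (T \<circ> f)" "path (T \<circ> g)"
      using assms(1,2) cont by (simp_all add: path_continuous_image)
    show "path_image (T \<circ> f) \<subseteq> cbox (T (Complex x0 y0)) (T (Complex x1 y1))"
      "path_image (T \<circ> g) \<subseteq> cbox (T (Complex x0 y0)) (T (Complex x1 y1))"
      by (intro sub; blast)+
  qed (use assms(4-) in \<open>auto simp: pathstart_compose pathfinish_compose T_def\<close>)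
  then show ?thesis using inj unfolding path_image_compose by blast
qed

text \<open>\<open>K\<close> need not contain a path from \<open>w1\<close> to \<open>w2\<close>, so
  \<open>fashoda_complex\<close> does not apply to it directly. An open connected neighbourhood of
  \<open>K\<close> does contain one, and if \<open>K\<close> missed the compact image of
  \<open>g\<close>, so would a thin enough neighbourhood. Horizontal and vertical extensions make
  the two paths join opposite sides of a common box.\<close>

lemma crossing_continuum_separates:
  fixes K :: "complex set" and g :: "real \<Rightarrow> complex"
  assumes K: "compact K" "connected K" and w: "w1 \<in> K" "w2 \<in> K"
    and K_box: "\<And>w. w \<in> K \<Longrightarrow> Re w \<in> {Re w1..Re w2} \<and> \<bar>Im w - y\<bar> \<le> r"
    and g: "path g" "\<And>w. w \<in> path_image g \<Longrightarrow> Re w \<in> {Re w1<..<Re w2}"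
    and ends: "Im (pathstart g) < y - r" "y + r < Im (pathfinish g)"
  shows "path_image g \<inter> K \<noteq> {}"
proof
  assume disj: "path_image g \<inter> K = {}"
  obtain \<epsilon>0 where \<epsilon>0: "\<epsilon>0 > 0" "\<And>a b. a \<in> path_image g \<Longrightarrow> b \<in> K \<Longrightarrow> \<epsilon>0 \<le> dist a b"
    using separate_compact_closed[OF compact_path_image[OF g(1)] compact_imp_closed[OF K(1)] disj] by blast
  \<comment> \<open>\<open>\<epsilon>0\<close> keeps the neighbourhood off \<open>g\<close>, the 1
    keeps it within the widened box, and the last two bounds keep it off the vertical extensions of
    \<open>g\<close>.\<close>
  define \<epsilon> where "\<epsilon> = min (min \<epsilon>0 1) (min (y - r - Im (pathstart g)) (Im (pathfinish g) - y - r))"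
  have \<epsilon>: "\<epsilon> > 0" "\<epsilon> \<le> \<epsilon>0" "\<epsilon> \<le> 1" "\<epsilon> \<le> y - r - Im (pathstart g)" "\<epsilon> \<le> Im (pathfinish g) - y - r"
    using \<epsilon>0 ends by (auto simp: \<epsilon>_def)
  define N where "N = (\<lambda>(a, b). a + b) ` (K \<times> ball 0 \<epsilon>)"
  have "connected N"
    unfolding N_def split_def
    by (intro connected_continuous_image continuous_intros connected_Times K connected_ball)
  moreover have "open N"
  proof -
    have "N = (\<Union>x\<in>K. \<Union>y\<in>ball 0 \<epsilon>. {x + y})" by (auto simp: N_def)
    moreover have "open (\<Union>x\<in>K. (+) x ` ball 0 \<epsilon>)"
      by (intro open_UN ballI open_translation open_ball)
    moreover have "(\<Union>x\<in>K. \<Union>y\<in>ball 0 \<epsilon>. {x + y}) = (\<Union>x\<in>K. (+) x ` ball 0 \<epsilon>)" by blast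
    ultimately show ?thesis by simp
  qed
  ultimately have "path_connected N" by (simp add: connected_open_path_connected)
  moreover have "K \<subseteq> N"
    unfolding N_def using \<epsilon>(1) by (force intro: image_eqI[of _ _ "(_, 0)"])
  ultimately obtain f0 where f0: "path f0" "path_image f0 \<subseteq> N" "pathstart f0 = w1" "pathfinish f0 = w2"
    using w unfolding path_connected_def by blast
  have N: "\<exists>b\<in>K. dist z b < \<epsilon>" if "z \<in> N" for z
    using that by (auto simp: N_def dist_norm intro!: bexI)
  have N_box: "Re z \<in> {Re w1 - 1..Re w2 + 1}" "\<bar>Im z - y\<bar> < r + \<epsilon>" if z: "z \<in> N" for z
  proof -
    obtain b where b: "b \<in> K" "dist z b < \<epsilon>" using N[OF z] by blast
    have "\<bar>Re z - Re b\<bar> < \<epsilon>" "\<bar>Im z - Im b\<bar> < \<epsilon>"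
      using b(2) abs_Re_le_cmod[of "z - b"] abs_Im_le_cmod[of "z - b"] by (auto simp: dist_norm)
    then show "Re z \<in> {Re w1 - 1..Re w2 + 1}" "\<bar>Im z - y\<bar> < r + \<epsilon>"
      using K_box[OF b(1)] \<epsilon> by auto
  qed
  \<comment> \<open>The added unit segments have abscissae at most \<open>Re w1\<close> or at least
    \<open>Re w2\<close>, where the extension of \<open>g\<close> never goes; hence any crossing of
    the two paths takes place in \<open>N\<close>.\<close>
  define f where "f = linepath (w1 - 1) w1 +++ f0 +++ linepath w2 (w2 + 1)"
  have f: "path f" "pathstart f = w1 - 1" "pathfinish f = w2 + 1"
    using f0 by (auto simp: f_def)
  have f_img: "z \<in> N \<or> (Re z \<in> {Re w1 - 1..Re w1} \<union> {Re w2..Re w2 + 1})" if "z \<in> path_image f" for z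
  proof -
    have "z \<in> closed_segment (w1 - 1) w1 \<or> z \<in> N \<or> z \<in> closed_segment w2 (w2 + 1)"
      using that f0 by (auto simp: f_def path_image_join)
    moreover have "Re z \<in> closed_segment (Re a) (Re b)" if "z \<in> closed_segment a b" for a b
      using that by (auto simp: closed_segment_def)
    moreover have "closed_segment (Re (w1 - 1)) (Re w1) = {Re w1 - 1..Re w1}"
      "closed_segment (Re w2) (Re (w2 + 1)) = {Re w2..Re w2 + 1}"
      by (simp_all add: closed_segment_eq_real_ivl)
    ultimately show ?thesis by blast
  qed
  have "bounded (path_image f \<union> path_image g)"
    using f(1) g(1) by (simp add: bounded_path_image)
  then obtain Y where Y: "\<forall>z \<in> path_image f \<union> path_image g. norm z \<le> Y"
    unfolding bounded_iff by blast
  define a where "a = pathstart g"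
  define b where "b = pathfinish g"
  have ab: "a \<in> path_image g" "b \<in> path_image g" by (auto simp: a_def b_def)
  define h where "h = linepath (Complex (Re a) (- Y)) a +++ g +++ linepath b (Complex (Re b) Y)"
  have h: "path h" "pathstart h = Complex (Re a) (- Y)" "pathfinish h = Complex (Re b) Y"
    using g by (auto simp: h_def a_def b_def)
  have Im_Y: "\<bar>Im z\<bar> \<le> Y" if "z \<in> path_image f \<union> path_image g" for z
    using bspec[OF Y that] abs_Im_le_cmod[of z] by linarith
  have h_img: "z \<in> path_image g \<or> Re z = Re a \<and> Im z \<in> {-Y..Im a} \<or> Re z = Re b \<and> Im z \<in> {Im b..Y}"
    if "z \<in> path_image h" for z
  proof -
    have "z \<in> closed_segment (Complex (Re a) (- Y)) a \<or> z \<in> path_image g \<or> z \<in> closed_segment b (Complex (Re b) Y)"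
      using that g by (auto simp: h_def path_image_join a_def b_def)
    moreover have "Re z \<in> closed_segment (Re u) (Re v) \<and> Im z \<in> closed_segment (Im u) (Im v)"
      if "z \<in> closed_segment u v" for u v
      using that by (auto simp: closed_segment_def)
    moreover have "closed_segment (- Y) (Im a) = {- Y..Im a}" "closed_segment (Im b) Y = {Im b..Y}"
      using Im_Y[of a] Im_Y[of b] ab by (simp_all add: closed_segment_eq_real_ivl)
    ultimately show ?thesis by (metis complex.sel closed_segment_idem singletonD)
  qed
  have Re_h: "Re z \<in> {Re w1<..<Re w2}" if "z \<in> path_image h" for z
    using h_img[OF that] g(2) ab by auto
  have "path_image f \<inter> path_image h \<noteq> {}"
  proof (rule fashoda_complex[OF f(1) h(1), of "Re w1 - 1" "Re w2 + 1" "- Y" Y])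
    have le: "Re w1 \<le> Re w2" using K_box[OF w(1)] by simp
    fix z assume "z \<in> path_image f \<union> path_image h"
    then show "Re z \<in> {Re w1 - 1..Re w2 + 1} \<and> Im z \<in> {- Y..Y}"
    proof
      assume z: "z \<in> path_image f"
      show ?thesis using f_img[OF z] N_box(1)[of z] Im_Y[of z] z le by auto
    next
      assume z: "z \<in> path_image h"
      show ?thesis using h_img[OF z] Re_h[OF z] Im_Y[of z] Im_Y[of a] Im_Y[of b] ab by auto
    qed
  qed (use f h in auto)
  then obtain z where z: "z \<in> path_image f" "z \<in> path_image h" by blast
  then have "z \<in> N" using f_img[OF z(1)] Re_h[OF z(2)] by auto
  moreover have "z \<notin> path_image g"
    using N[OF \<open>z \<in> N\<close>] \<epsilon>0(2)[of z] \<epsilon>(2) by force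
  ultimately show False
    using h_img[OF z(2)] N_box(2)[of z] \<epsilon>(4,5) by (auto simp: a_def b_def)
qed

text \<open>If the component of \<open>z\<close> in the part of \<open>C\<close> in the closed ball
  stayed inside the open ball, the Sura-Bura theorem would enclose it in a relatively clopen set
  \<open>T\<close>, still inside the open ball. Such a \<open>T\<close> is clopen in
  \<open>C\<close> itself, which is impossible because \<open>C\<close> is connected and leaves the
  ball.\<close>

lemma boundary_bumping_ball:
  fixes C :: "'a::euclidean_space set"
  assumes "closed C" "connected C" "z \<in> C" "\<rho> > 0" and "\<not> C \<subseteq> cball z \<rho>"
  obtains K z' where "compact K" "connected K" "z \<in> K" "K \<subseteq> C \<inter> cball z \<rho>" "z' \<in> K" "dist z z' = \<rho>"
proof -
  define S where "S = C \<inter> cball z \<rho>"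
  have S: "compact S" "z \<in> S" using assms by (auto simp: S_def closed_Int_compact)
  define K where "K = connected_component_set S z"
  have K: "K \<in> components S" "z \<in> K" "connected K" "K \<subseteq> S" "compact K"
    using S compact_components[OF S(1)]
    by (auto simp: K_def componentsI connected_component_refl connected_component_subset)
  have "\<not> K \<subseteq> ball z \<rho>"
  proof
    assume "K \<subseteq> ball z \<rho>"
    moreover have "locally compact S" using S(1) by (simp add: closed_imp_locally_compact compact_imp_closed)
    ultimately obtain T where T: "openin (top_of_set S) T" "compact T" "K \<subseteq> T" "T \<subseteq> ball z \<rho>"
      using Sura_Bura_clopen_subset[of S K "ball z \<rho>"] K(1,5) open_ball by metis
    then obtain W where W: "open W" "T = S \<inter> W" by (auto simp: openin_open)
    \<comment> \<open>Inside the open ball the restriction to \<open>cball z \<rho>\<close> is not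
      felt, so relative openness passes from \<open>S\<close> to \<open>C\<close>.\<close>
    have eq: "T = C \<inter> (W \<inter> ball z \<rho>)" using W(2) T(4) by (auto simp: S_def)
    have "openin (top_of_set C) T"
      unfolding eq by (intro openin_open_Int open_Int W(1) open_ball)
    moreover have "closedin (top_of_set C) T"
      unfolding eq[symmetric] using eq T(2) by (intro closed_subset compact_imp_closed) auto
    ultimately have "T = {} \<or> T = C" using assms(2) by (auto simp: connected_clopen)
    then show False using T K(2) assms(5) ball_subset_cball by blast
  qed
  then obtain z' where z': "z' \<in> K" "z' \<notin> ball z \<rho>" by blast
  then have "dist z z' = \<rho>" using K(4) by (auto simp: S_def)
  then show ?thesis using that[of K z'] K z' by (auto simp: S_def)
qed

section \<open>Flow boxes\<close>

text \<open>Logarithmic polar coordinates at \<open>c\<close>: \<open>Re w\<close> labels a circle,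
  and \<open>Im w\<close> is the time of a rotation with angular speed \<omega>.\<close>

definition rotation_chart :: "complex \<Rightarrow> real \<Rightarrow> complex \<Rightarrow> complex" where
  "rotation_chart c \<omega> w = c + exp (of_real \<omega> * w)"

lemma rotation_chart_surj:
  assumes "z \<noteq> c" "\<omega> \<noteq> 0"
  obtains w where "rotation_chart c \<omega> w = z" "Re w = ln (dist c z) / \<omega>"
proof -
  define w where "w = Ln (z - c) / of_real \<omega>"
  have "rotation_chart c \<omega> w = z" using assms by (simp add: rotation_chart_def w_def)
  moreover have "Re w = ln (dist c z) / \<omega>"
    using assms by (simp add: w_def Re_divide_of_real dist_norm norm_minus_commute)
  ultimately show ?thesis using that by blast
qed

lemma dist_rotation_chart: "dist c (rotation_chart c \<omega> w) = exp (\<omega> * Re w)"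
  by (simp add: rotation_chart_def dist_norm)

text \<open>\<open>E\<close> straightens the flow: orbits are the images of vertical lines, and
  height is time. For rotations \<open>E\<close> is periodic, so injectivity is asked on horizontal
  strips only, at every height \<open>y\<close>. Nullity has to pass from \<open>A\<close> into the
  chart and from the chart back to the plane.\<close>

locale kakeya_chart = screw_flow +
  fixes E :: "complex \<Rightarrow> complex" and h :: real and A :: "complex set"
  assumes h_pos: "h > 0"
    and E_shift: "E (w + \<i> * of_real s) = flow s (E w)"
    and cont_E: "continuous_on UNIV E"
    and inj_E: "inj_on E {w. \<bar>Im w - y\<bar> < h}"
    and negligible_E_image: "negligible S \<Longrightarrow> negligible (E ` S)"
    and negligible_E_vimage: "negligible S \<Longrightarrow> negligible (E -` S)"
    and closed_A: "closed A" and negligible_A: "negligible A"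
    and small_moves: "\<forall>e>0. \<exists>\<delta> v d. 0 < \<delta> \<and> \<delta> < e \<and> small_move A \<delta> (\<delta>\<^sup>2) v d \<and>
        norm (v 1 - 1 - \<delta> * (\<i> * \<omega>)) \<le> e * \<delta> \<and> norm (d 1 - \<delta> * \<tau>) \<le> e * \<delta>"
begin

text \<open>Invariance of domain gives the open image and the continuous inverse from continuity and
  injectivity alone, uniformly for both kinds of flow.\<close>

lemma chart_inverse:
  assumes "open Q" "Q \<subseteq> {w. \<bar>Im w - y\<bar> < h}"
  obtains L where "open (E ` Q)" "continuous_on (E ` Q) L" "\<And>w. w \<in> Q \<Longrightarrow> L (E w) = w"
proof -
  have inj: "inj_on E Q" using inj_E assms(2) by (rule inj_on_subset)
  have cont: "continuous_on Q E" using cont_E by (rule continuous_on_subset) simp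
  obtain L where L: "homeomorphism Q (E ` Q) E L"
    using invariance_of_domain_homeomorphism[OF assms(1) cont _ inj] by auto
  show ?thesis
    using that[of L] invariance_of_domain[OF cont assms(1) inj] L by (auto simp: homeomorphism_def)
qed

text \<open>If \<open>K\<close> were not contained in a vertical line, it would separate the bottom of a box
  from its top, whereas \<open>flow_path_avoiding\<close> climbs through the box outside \<open>E -` A\<close>.\<close>

lemma Re_const_on_continuum:
  assumes K: "compact K" "connected K" and EK: "E ` K \<subseteq> A"
    and r: "0 < r" "2 * r \<le> h" "\<And>w. w \<in> K \<Longrightarrow> \<bar>Im w - y\<bar> \<le> r"
    and "u1 \<in> K" "u2 \<in> K"
  shows "Re u1 = Re u2"
proof (rule ccontr)
  assume ne: "Re u1 \<noteq> Re u2"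
  have contRe: "continuous_on K Re" by (intro continuous_intros)
  obtain w1 where w1: "w1 \<in> K" "\<And>w. w \<in> K \<Longrightarrow> Re w1 \<le> Re w"
    using continuous_attains_inf[OF K(1) _ contRe] assms by blast
  obtain w2 where w2: "w2 \<in> K" "\<And>w. w \<in> K \<Longrightarrow> Re w \<le> Re w2"
    using continuous_attains_sup[OF K(1) _ contRe] assms by blast
  have lt: "Re w1 < Re w2"
    using ne w1(2)[of u1] w1(2)[of u2] w2(2)[of u1] w2(2)[of u2] assms by linarith
  define Q where "Q = {w. Re w \<in> {Re w1<..<Re w2} \<and> \<bar>Im w - y\<bar> < 2 * r}"
  have Q_eq: "Q = {w. Re w1 < Re w} \<inter> {w. Re w < Re w2} \<inter> {w. Im w < y + 2 * r} \<inter> {w. y - 2 * r < Im w}"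
    by (auto simp: Q_def abs_less_iff)
  have "open Q" unfolding Q_eq
    by (intro open_Int open_halfspace_Re_lt open_halfspace_Re_gt open_halfspace_Im_lt open_halfspace_Im_gt)
  moreover have Qh: "Q \<subseteq> {w. \<bar>Im w - y\<bar> < h}" using r(2) by (auto simp: Q_def)
  ultimately obtain L where L: "open (E ` Q)" "continuous_on (E ` Q) L" "\<And>w. w \<in> Q \<Longrightarrow> L (E w) = w"
    using chart_inverse by metis
  define Qp where "Qp = Q \<inter> {w. y + r < Im w}"
  have oQp: "open Qp" unfolding Qp_def by (intro open_Int \<open>open Q\<close> open_halfspace_Im_gt)
  have "Qp \<subseteq> {w. \<bar>Im w - y\<bar> < h}" using Qh by (auto simp: Qp_def)
  then have oEQp: "open (E ` Qp)" using chart_inverse[OF oQp] by metis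
  define \<rho> where "\<rho> = min (r / 4) ((Re w2 - Re w1) / 4)"
  have \<rho>: "\<rho> > 0" "\<rho> \<le> r / 4" "\<rho> \<le> (Re w2 - Re w1) / 4"
    using r lt unfolding \<rho>_def by (simp_all only: min.cobounded1 min.cobounded2 min_less_iff_conj) auto
  define xm where "xm = (Re w1 + Re w2) / 2"
  have xm: "Re w1 < xm - \<rho>" "xm + \<rho> < Re w2" using \<rho> by (simp_all add: xm_def field_simps)
  \<comment> \<open>The start lies 3/2 r below height y, and time 3 r lifts it to 3/2 r above. As
    \<open>\<rho> \<le> r / 4\<close>, the starting ball and its lifted copy both clear the band of
    half-height r around \<open>K\<close>, and the sweep between them stays in
    \<open>Q'\<close>.\<close>
  define wm where "wm = Complex xm (y - 3 / 2 * r)"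
  define s where "s = 3 * r"
  have near: "\<bar>Re w - Re c\<bar> \<le> \<rho>" "\<bar>Im w - Im c\<bar> \<le> \<rho>" if "dist c w \<le> \<rho>" for w c
    using that abs_Re_le_cmod[of "w - c"] abs_Im_le_cmod[of "w - c"] by (auto simp: dist_norm norm_minus_commute)
  define Q' where "Q' = cbox (Complex (xm - \<rho>) (y - 7 / 4 * r)) (Complex (xm + \<rho>) (y + 7 / 4 * r))"
  have "Q' \<subseteq> Q" using xm r(1)
    by (auto simp: Q'_def Q_def in_cbox_complex_iff abs_less_iff)
  moreover have "compact (E ` Q')"
    unfolding Q'_def by (intro compact_continuous_image continuous_on_subset[OF cont_E]) auto
  ultimately obtain \<eta>1 where \<eta>1: "\<eta>1 > 0" "(\<Union>x\<in>E ` Q'. ball x \<eta>1) \<subseteq> E ` Q"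
    using compact_subset_open_imp_ball_epsilon_subset[OF _ L(1)] by (metis image_mono)
  have "cball (wm + \<i> * s) \<rho> \<subseteq> Qp"
  proof
    fix w assume "w \<in> cball (wm + \<i> * s) \<rho>"
    then have "dist (wm + \<i> * s) w \<le> \<rho>" by simp
    from near[OF this] show "w \<in> Qp" using xm \<rho>(2) r(1)
      by (auto simp: Qp_def Q_def wm_def s_def abs_le_iff abs_less_iff)
  qed
  moreover have "compact (E ` cball (wm + \<i> * s) \<rho>)"
    by (intro compact_continuous_image continuous_on_subset[OF cont_E]) auto
  ultimately obtain \<eta>2 where \<eta>2: "\<eta>2 > 0" "(\<Union>x\<in>E ` cball (wm + \<i> * s) \<rho>. ball x \<eta>2) \<subseteq> E ` Qp"
    using compact_subset_open_imp_ball_epsilon_subset[OF _ oEQp] by (metis image_mono)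
  have ballQ': "w + \<i> * \<sigma> \<in> Q'" if "dist wm w < \<rho>" "\<sigma> \<in> {0..s}" for w \<sigma>
    using near[of wm w] that \<rho> r(1)
    by (auto simp: Q'_def in_cbox_complex_iff wm_def s_def abs_le_iff)
  have ballQ: "w \<in> Q" if "dist wm w < \<rho>" for w
    using ballQ'[OF that, of 0] \<open>Q' \<subseteq> Q\<close> r(1) by (auto simp: s_def)
  have "open (E ` ball wm \<rho>)"
    using chart_inverse[of "ball wm \<rho>"] ballQ Qh by (metis mem_ball open_ball subsetD subsetI)
  moreover have "E ` ball wm \<rho> \<noteq> {}" using \<rho> by simp
  \<comment> \<open>Closeness \<eta>1 to the flow line lets \<open>L\<close> pull the path back into
    \<open>Q\<close>; closeness \<eta>2 at the end puts its endpoint above \<open>K\<close>.\<close>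
  moreover have "s \<ge> 0" "min \<eta>1 \<eta>2 > 0" using \<eta>1 \<eta>2 r by (auto simp: s_def)
  ultimately obtain p q where p: "p \<in> E ` ball wm \<rho>" and q: "dist q (flow s p) < min \<eta>1 \<eta>2"
    and pq: "path_component ({x. \<exists>\<sigma>\<in>{0..s}. dist x (flow \<sigma> p) < min \<eta>1 \<eta>2} - A) p q"
    by (rule flow_path_avoiding[OF small_moves])
  obtain w where w: "dist wm w < \<rho>" "p = E w" using p by auto
  obtain g where g: "path g" "path_image g \<subseteq> {x. \<exists>\<sigma>\<in>{0..s}. dist x (flow \<sigma> p) < min \<eta>1 \<eta>2} - A"
      "pathstart g = p" "pathfinish g = q"
    using pq unfolding path_component_def by blast
  have gQ: "path_image g \<subseteq> E ` Q"
  proof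
    fix x assume "x \<in> path_image g"
    then obtain \<sigma> where \<sigma>: "\<sigma> \<in> {0..s}" "dist x (flow \<sigma> p) < min \<eta>1 \<eta>2" using g(2) by blast
    have "flow \<sigma> p = E (w + \<i> * \<sigma>)" by (simp add: w E_shift)
    then have "flow \<sigma> p \<in> E ` Q'" using ballQ'[OF w(1) \<sigma>(1)] by blast
    moreover have "x \<in> ball (flow \<sigma> p) \<eta>1" using \<sigma>(2) by (simp add: dist_commute)
    ultimately show "x \<in> E ` Q" using \<eta>1(2) by blast
  qed
  have gA: "path_image g \<inter> A = {}" using g(2) by blast
  have EL: "L z \<in> Q \<and> E (L z) = z" if "z \<in> E ` Q" for z using that L(3) by auto
  have "flow s p = E (w + \<i> * s)" by (simp add: w E_shift)
  moreover have "w + \<i> * s \<in> cball (wm + \<i> * s) \<rho>" using w(1) by simp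
  moreover have "q \<in> ball (flow s p) \<eta>2" using q by (simp add: dist_commute)
  ultimately have "q \<in> E ` Qp" using \<eta>2(2) by blast
  then have Lq: "y + r < Im (L q)" using L(3) by (auto simp: Qp_def)
  have Lp: "Im (L p) < y - r"
    using near(2)[of wm w] w ballQ[OF w(1)] L(3) \<rho> r(1) by (auto simp: wm_def abs_le_iff)
  have path: "path (L \<circ> g)"
    by (intro path_continuous_image g continuous_on_subset[OF L(2) gQ])
  have "path_image (L \<circ> g) \<inter> K \<noteq> {}"
  proof (rule crossing_continuum_separates[OF K w1(1) w2(1) _ path])
    show "Re w \<in> {Re w1..Re w2} \<and> \<bar>Im w - y\<bar> \<le> r" if "w \<in> K" for w
      using w1(2) w2(2) r(3) that by auto
    show "Re w \<in> {Re w1<..<Re w2}" if "w \<in> path_image (L \<circ> g)" for w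
      using that gQ EL unfolding path_image_compose Q_def by blast
    show "Im (pathstart (L \<circ> g)) < y - r" "y + r < Im (pathfinish (L \<circ> g))"
      using Lp Lq g by (simp_all add: pathstart_compose pathfinish_compose)
  qed
  then obtain z where z: "z \<in> path_image g" "L z \<in> K" unfolding path_image_compose by blast
  then have "z \<in> A" using EK EL gQ by (metis image_subset_iff subsetD)
  then show False using z gA by blast
qed

text \<open>Labels of the orbits that have an arc in \<open>A\<close>. Rational end times leave only
  countably many time intervals to consider.\<close>

definition arc_abscissae :: "real set" where
  "arc_abscissae = {x. \<exists>a\<in>\<rat>. \<exists>b\<in>\<rat>. a < b \<and> (\<forall>t\<in>{a..b}. E (Complex x t) \<in> A)}"

text \<open>Boundary bumping cuts out of the component a nondegenerate continuum so close to
  \<open>E w\<close> that one chart contains it. There \<open>Re_const_on_continuum\<close> makes it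
  vertical, and its heights, being connected, fill an interval with room for rational
  endpoints.\<close>

lemma Re_mem_arc_abscissae:
  assumes C: "C \<in> nontrivial_components A" and "E w \<in> C"
  shows "Re w \<in> arc_abscissae"
proof -
  have C': "C \<in> components A" "closed C" "connected C" "C \<subseteq> A"
    using C closed_A
    by (auto simp: nontrivial_components_def closed_components in_components_connected dest: in_components_subset)
  define z where "z = E w"
  have "\<exists>x\<in>C. \<exists>y\<in>C. x \<noteq> y" using C by (simp add: nontrivial_components_def)
  then obtain z2 where z2: "z2 \<in> C" "z2 \<noteq> z" by blast
  \<comment> \<open>This radius fits the condition \<open>2 * r \<le> h\<close> of
    \<open>Re_const_on_continuum\<close> with \<open>r = h / 2\<close>.\<close>
  define Q where "Q = ball w (h / 2)"
  have Qb: "\<bar>Im v - Im w\<bar> < h / 2" if "v \<in> Q" for v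
    using that abs_Im_le_cmod[of "v - w"] by (auto simp: Q_def dist_norm norm_minus_commute)
  then have "Q \<subseteq> {v. \<bar>Im v - Im w\<bar> < h}" using h_pos by force
  then obtain L where L: "open (E ` Q)" "continuous_on (E ` Q) L" "\<And>w. w \<in> Q \<Longrightarrow> L (E w) = w"
    using chart_inverse[of Q "Im w"] by (metis Q_def open_ball)
  have EL: "L z \<in> Q \<and> E (L z) = z" if "z \<in> E ` Q" for z using that L(3) by auto
  have "w \<in> Q" using h_pos by (simp add: Q_def)
  then have "z \<in> E ` Q" by (simp add: z_def)
  then obtain \<rho>1 where \<rho>1: "\<rho>1 > 0" "cball z \<rho>1 \<subseteq> E ` Q" using L(1) open_contains_cball by blast
  \<comment> \<open>Smaller than the distance to a second point of \<open>C\<close>, so that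
    \<open>C\<close> leaves the ball, as boundary bumping requires.\<close>
  define \<rho> where "\<rho> = min \<rho>1 (dist z z2 / 2)"
  have \<rho>: "\<rho> > 0" "\<rho> \<le> \<rho>1" "\<rho> < dist z z2"
    using \<rho>1 z2 by (auto simp: \<rho>_def min_less_iff_disj)
  then have "\<not> C \<subseteq> cball z \<rho>" using z2 by (auto simp: subset_iff)
  then obtain K z' where K: "compact K" "connected K" "z \<in> K" "K \<subseteq> C \<inter> cball z \<rho>"
      and z': "z' \<in> K" "dist z z' = \<rho>"
    using boundary_bumping_ball[OF C'(2,3) _ \<rho>(1), of z] assms(2) z_def by metis
  have KQ: "K \<subseteq> E ` Q" using K(4) \<rho>1(2) subset_cball[OF \<rho>(2), of z] by blast
  have contL: "continuous_on K L" using L(2) KQ by (rule continuous_on_subset)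
  have LK: "compact (L ` K)" "connected (L ` K)"
    using contL K by (auto intro: compact_continuous_image connected_continuous_image)
  have ELK: "E v \<in> K \<and> v \<in> Q" if "v \<in> L ` K" for v using that EL KQ by auto
  have Lz: "L z = w" using L(3) \<open>w \<in> Q\<close> by (simp add: z_def)
  have Re: "Re v = Re w" if "v \<in> L ` K" for v
  proof (rule Re_const_on_continuum[OF LK, of "h / 2" "Im w"])
    show "E ` L ` K \<subseteq> A" using ELK K(4) C'(4) by blast
    show "\<bar>Im v - Im w\<bar> \<le> h / 2" if "v \<in> L ` K" for v using Qb ELK[OF that] by (simp add: less_imp_le)
    show "w \<in> L ` K" using Lz K(3) by blast
  qed (use h_pos that in auto)
  define w' where "w' = L z'"
  have w': "w' \<in> L ` K" using z' by (simp add: w'_def)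
  have "w' \<noteq> w" using EL KQ z' \<rho>(1) Lz z_def w'_def by (metis dist_self less_irrefl subsetD)
  then have "Im w' \<noteq> Im w" using Re[OF w'] by (simp add: complex_eq_iff)
  then obtain lo hi where lohi: "lo < hi" "lo \<in> Im ` L ` K" "hi \<in> Im ` L ` K"
    using w' Lz K(3) by (metis imageI linorder_neqE_linordered_idom)
  have "connected (Im ` L ` K)" by (intro connected_continuous_image LK continuous_intros)
  then have sub: "{lo..hi} \<subseteq> Im ` L ` K" using lohi by (simp add: connected_contains_Icc)
  obtain a where a: "a \<in> \<rat>" "lo < a" "a < hi" using Rats_dense_in_real[OF lohi(1)] by blast
  obtain b where b: "b \<in> \<rat>" "a < b" "b < hi" using Rats_dense_in_real[OF a(3)] by blast
  have "E (Complex (Re w) t) \<in> A" if "t \<in> {a..b}" for t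
  proof -
    have "t \<in> Im ` L ` K" using that a b sub by auto
    then obtain v where v: "v \<in> L ` K" "t = Im v" by blast
    then have "v = Complex (Re w) t" using Re[OF v(1)] by (simp add: complex_eq_iff)
    then show ?thesis using ELK[OF v(1)] K(4) C'(4) by blast
  qed
  then show ?thesis using a b unfolding arc_abscissae_def by blast
qed

text \<open>The shifts of a vertical segment over \<open>{a..b}\<close> by integer multiples of b -
  a cover its whole line. Each shift is applied to the entire null preimage of \<open>A\<close>,
  which serves all abscissae at once, so countably many null sets suffice.\<close>

lemma negligible_Re_vimage_arc_abscissae: "negligible (Re -` arc_abscissae)"
proof -
  define F where "F = (\<lambda>(a::real, b::real, k::int). (+) (\<i> * of_real (of_int k * (b - a))) ` (E -` A))"
  have neg: "negligible (\<Union>(F ` (\<rat> \<times> \<rat> \<times> UNIV)))"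
  proof (rule negligible_countable_Union)
    show "countable (F ` (\<rat> \<times> \<rat> \<times> UNIV))"
      by (intro countable_image countable_SIGMA countable_rat) auto
    show "negligible S" if "S \<in> F ` (\<rat> \<times> \<rat> \<times> UNIV)" for S
      using that negligible_A by (auto simp: F_def intro!: negligible_translation negligible_E_vimage)
  qed
  have "Re -` arc_abscissae \<subseteq> \<Union>(F ` (\<rat> \<times> \<rat> \<times> UNIV))"
  proof
    fix w assume "w \<in> Re -` arc_abscissae"
    then obtain a b where ab: "a \<in> \<rat>" "b \<in> \<rat>" "a < b" "\<And>t. t \<in> {a..b} \<Longrightarrow> E (Complex (Re w) t) \<in> A"
      unfolding arc_abscissae_def by blast
    define k where "k = \<lfloor>(Im w - a) / (b - a)\<rfloor>"
    have "of_int k \<le> (Im w - a) / (b - a)" "(Im w - a) / (b - a) < of_int k + 1"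
      unfolding k_def by linarith+
    then have "Im w - of_int k * (b - a) \<in> {a..b}" using ab(3) by (simp add: field_simps)
    then have "Complex (Re w) (Im w - of_int k * (b - a)) \<in> E -` A" using ab(4) by simp
    moreover have "w = \<i> * of_real (of_int k * (b - a)) + Complex (Re w) (Im w - of_int k * (b - a))"
      by (simp add: complex_eq_iff)
    ultimately have "w \<in> F (a, b, k)" unfolding F_def by force
    then show "w \<in> \<Union>(F ` (\<rat> \<times> \<rat> \<times> UNIV))" using ab(1,2) by blast
  qed
  with neg show ?thesis by (rule negligible_subset)
qed

text \<open>Otherwise a nonempty open vertical strip would be null.\<close>

lemma arc_abscissae_no_interval:
  assumes "x0 < x1"
  obtains x where "x \<in> {x0<..<x1}" "x \<notin> arc_abscissae"
proof (rule ccontr)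
  assume "\<not> thesis"
  then have "{x0<..<x1} \<subseteq> arc_abscissae" using that by blast
  then have "{w. x0 < Re w} \<inter> {w. Re w < x1} \<subseteq> Re -` arc_abscissae" by auto
  then have "negligible ({w. x0 < Re w} \<inter> {w. Re w < x1})"
    using negligible_Re_vimage_arc_abscissae negligible_subset by blast
  moreover have "open ({w. x0 < Re w} \<inter> {w. Re w < x1})"
    by (intro open_Int open_halfspace_Re_lt open_halfspace_Re_gt)
  moreover have "Complex ((x0 + x1) / 2) 0 \<in> {w. x0 < Re w} \<inter> {w. Re w < x1}" using assms by simp
  ultimately show False using open_not_negligible by blast
qed

end

text \<open>If the distance to the centre took two values on a component, it would take a whole
  interval of them, but \<open>arc_abscissae\<close> has empty interior. In particular no nontrivial
  component contains the centre.\<close>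

lemma (in kakeya_chart) nontrivial_component_subset_sphere:
  assumes E: "E = rotation_chart c \<kappa>" and "\<kappa> \<noteq> 0" and C: "C \<in> nontrivial_components A"
  obtains r where "r > 0" "C \<subseteq> sphere c r"
proof -
  have conn: "connected C" using C by (auto simp: nontrivial_components_def in_components_connected)
  have not_less: "\<not> dist c z1 < dist c z2" if z: "z1 \<in> C" "z2 \<in> C" for z1 z2
  proof
    assume less: "dist c z1 < dist c z2"
    \<comment> \<open>\<open>z1\<close> might be the centre, which has no abscissa; the two
      intermediate radii are positive in any case.\<close>
    obtain r1 r2 where r: "dist c z1 < r1" "r1 < r2" "r2 < dist c z2"
      using dense[OF less] dense by meson
    then have "r1 > 0" using zero_le_dist[of c z1] by linarith
    define u v where "u = ln r1 / \<kappa>" and "v = ln r2 / \<kappa>"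
    have lnr: "ln r1 < ln r2" using r \<open>r1 > 0\<close> by simp
    have "u \<noteq> v" using lnr \<open>\<kappa> \<noteq> 0\<close> by (simp add: u_def v_def)
    \<comment> \<open>A negative \<kappa> reverses the order of the two abscissae.\<close>
    then have "min u v < max u v" by (simp add: min_def max_def)
    then obtain x where x: "x \<in> {min u v<..<max u v}" "x \<notin> arc_abscissae"
      using arc_abscissae_no_interval by metis
    have "\<kappa> * x \<in> {ln r1<..<ln r2}"
      using x(1) lnr \<open>\<kappa> \<noteq> 0\<close> unfolding u_def v_def
      by (cases "\<kappa> > 0") (auto simp: min_def max_def field_simps split: if_splits)
    then have "exp (ln r1) < exp (\<kappa> * x)" "exp (\<kappa> * x) < exp (ln r2)" by simp_all
    then have "r1 < exp (\<kappa> * x)" "exp (\<kappa> * x) < r2" using \<open>r1 > 0\<close> r(2) by simp_all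
    moreover have "connected (dist c ` C)" by (intro connected_continuous_image continuous_intros conn)
    then have "{dist c z1..dist c z2} \<subseteq> dist c ` C" using z by (simp add: connected_contains_Icc)
    ultimately have "exp (\<kappa> * x) \<in> dist c ` C" using r by auto
    then obtain z where z: "z \<in> C" "dist c z = exp (\<kappa> * x)" by (metis imageE)
    then have "z \<noteq> c" by (metis dist_self exp_not_eq_zero)
    then obtain w where w: "rotation_chart c \<kappa> w = z" "Re w = ln (dist c z) / \<kappa>"
      using rotation_chart_surj \<open>\<kappa> \<noteq> 0\<close> by metis
    have "Re w = x" using w(2) z(2) \<open>\<kappa> \<noteq> 0\<close> by simp
    moreover have "Re w \<in> arc_abscissae" using Re_mem_arc_abscissae[OF C] w(1) z(1) E by simp
    ultimately show False using x(2) by simp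
  qed
  have "\<exists>x\<in>C. \<exists>y\<in>C. x \<noteq> y" using C by (simp add: nontrivial_components_def)
  then obtain x where x: "x \<in> C" "x \<noteq> c" by blast
  have "dist c z = dist c x" if "z \<in> C" for z
    using not_less[OF that x(1)] not_less[OF x(1) that] by linarith
  then have "C \<subseteq> sphere c (dist c x)" by auto
  then show ?thesis using that[of "dist c x"] x(2) by simp
qed

text \<open>The function \<open>f\<close> of the proof is the abscissa in the chart, a real
  coordinate transverse to \<tau>. Its values on a component form a connected subset of
  \<open>arc_abscissae\<close>, which contains no interval, so \<open>f\<close> is constant
  there.\<close>

lemma (in kakeya_chart) nontrivial_component_subset_line:
  assumes E: "E = (\<lambda>w. - \<i> * \<tau> * w)" and "\<tau> \<noteq> 0" and C: "C \<in> nontrivial_components A"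
  obtains p where "C \<subseteq> range (\<lambda>t. p + t *\<^sub>R \<tau>)"
proof -
  have conn: "connected C" using C by (auto simp: nontrivial_components_def in_components_connected)
  define f where "f z = - Im (z / \<tau>)" for z
  have E_inv: "E (\<i> * z / \<tau>) = z" for z using \<open>\<tau> \<noteq> 0\<close> by (simp add: E)
  have Re_eq: "Re (\<i> * z / \<tau>) = f z" for z
    unfolding f_def times_divide_eq_right[symmetric] by (rule Re_i_times)
  have not_less: "\<not> f z1 < f z2" if z: "z1 \<in> C" "z2 \<in> C" for z1 z2
  proof
    assume "f z1 < f z2"
    then obtain x where x: "x \<in> {f z1<..<f z2}" "x \<notin> arc_abscissae"
      using arc_abscissae_no_interval by metis
    have "connected (f ` C)"
      unfolding f_def using \<open>\<tau> \<noteq> 0\<close> by (intro connected_continuous_image continuous_intros conn) auto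
    then have "{f z1..f z2} \<subseteq> f ` C" using z by (simp add: connected_contains_Icc)
    then have "x \<in> f ` C" using x(1) by auto
    then obtain z where "z \<in> C" "x = f z" by blast
    then show False
      using Re_mem_arc_abscissae[OF C, of "\<i> * z / \<tau>"] x(2) by (simp add: E_inv Re_eq)
  qed
  have "\<exists>x\<in>C. \<exists>y\<in>C. x \<noteq> y" using C by (simp add: nontrivial_components_def)
  then obtain x where x: "x \<in> C" by blast
  have "z \<in> range (\<lambda>t. x + t *\<^sub>R \<tau>)" if "z \<in> C" for z
  proof -
    have "f z = f x" using not_less x that by (metis linorder_neqE_linordered_idom)
    then have "Im ((z - x) / \<tau>) = 0" by (simp add: f_def diff_divide_distrib)
    then have "(z - x) / \<tau> = of_real (Re ((z - x) / \<tau>))" by (simp add: complex_eq_iff)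
    then have "z = x + Re ((z - x) / \<tau>) *\<^sub>R \<tau>"
      using \<open>\<tau> \<noteq> 0\<close> by (simp add: scaleR_conv_of_real field_simps)
    then show ?thesis by blast
  qed
  then show ?thesis using that by blast
qed

lemma (in kakeya_chart) negligible_nontrivial_cover:
  "negligible (E ` (Re -` arc_abscissae))"
  by (intro negligible_E_image negligible_Re_vimage_arc_abscissae)

section \<open>The two charts\<close>

text \<open>Two branches of the logarithm, cut along the negative and the positive real axis, are
  differentiable and together reach every nonzero point. All other logarithms are translates by
  multiples of 2 pi \<i>, of which there are countably many.\<close>

lemma negligible_exp_vimage:
  fixes S :: "complex set"
  assumes "negligible S"
  shows "negligible (exp -` S)"
proof -
  define P where "P = Ln ` (S - \<real>\<^sub>\<le>\<^sub>0)"
  define P' where "P' = (\<lambda>z. Ln (- z) + \<i> * pi) ` (S - uminus ` \<real>\<^sub>\<le>\<^sub>0)"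
  have "Ln differentiable_on (S - \<real>\<^sub>\<le>\<^sub>0)"
    unfolding differentiable_on_def
    by (intro ballI field_differentiable_imp_differentiable field_differentiable_within_Ln) auto
  then have "negligible P"
    unfolding P_def by (intro negligible_differentiable_image_negligible negligible_diff assms) auto
  moreover have "((\<lambda>z. Ln (- z) + \<i> * pi) has_field_derivative 1 / z) (at z within T)"
    if "z \<in> S - uminus ` \<real>\<^sub>\<le>\<^sub>0" for z T
  proof -
    have "- z \<notin> \<real>\<^sub>\<le>\<^sub>0" using that by (metis Diff_iff add.inverse_inverse imageI)
    then show ?thesis by (auto intro!: derivative_eq_intros simp: field_simps)
  qed
  then have "(\<lambda>z. Ln (- z) + \<i> * pi) differentiable_on (S - uminus ` \<real>\<^sub>\<le>\<^sub>0)"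
    unfolding differentiable_on_def
    by (meson field_differentiable_def field_differentiable_imp_differentiable)
  then have "negligible P'"
    unfolding P'_def by (intro negligible_differentiable_image_negligible negligible_diff assms) auto
  ultimately have "negligible (P \<union> P')" by (rule negligible_Un)
  then have "negligible (\<Union>n::int. (+) (of_real (of_int (2 * n) * pi) * \<i>) ` (P \<union> P'))"
    by (intro negligible_countable_Union) (auto intro: negligible_translation)
  moreover have "exp -` S \<subseteq> (\<Union>n::int. (+) (of_real (of_int (2 * n) * pi) * \<i>) ` (P \<union> P'))"
  proof
    fix w :: complex assume w: "w \<in> exp -` S"
    have "\<exists>v\<in>P \<union> P'. exp w = exp v"
    proof (cases "exp w \<in> \<real>\<^sub>\<le>\<^sub>0")
      case False
      then have "Ln (exp w) \<in> P" "exp w = exp (Ln (exp w))" using w by (auto simp: P_def)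
      then show ?thesis by blast
    next
      case True
      have "exp w \<notin> uminus ` \<real>\<^sub>\<le>\<^sub>0"
        using True exp_not_eq_zero[of w] by (auto elim!: nonpos_Reals_cases)
      then have "Ln (- exp w) + \<i> * pi \<in> P'" using w by (auto simp: P'_def)
      moreover have "exp w = exp (Ln (- exp w) + \<i> * pi)" by (simp add: exp_add)
      ultimately show ?thesis by blast
    qed
    then obtain v n where "v \<in> P \<union> P'" "w = v + of_real (of_int (2 * n) * pi) * \<i>"
      unfolding exp_eq by blast
    then show "w \<in> (\<Union>n::int. (+) (of_real (of_int (2 * n) * pi) * \<i>) ` (P \<union> P'))"
      by (auto simp: add.commute)
  qed
  ultimately show ?thesis by (rule negligible_subset)
qed

text \<open>\<open>c\<close> is the zero of the generator
  \<open>z \<mapsto> \<i> * \<omega> * z + \<tau>\<close>, hence the centre of the rotations. A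
  strip of half-height \<open>pi / \<bar>\<omega>\<bar>\<close> is exactly one period of the
  chart.\<close>

lemma kakeya_chart_rotation:
  assumes "\<omega> \<noteq> 0" "closed A" "negligible A"
    and small: "\<forall>e>0. \<exists>\<delta> v d. 0 < \<delta> \<and> \<delta> < e \<and> small_move A \<delta> (\<delta>\<^sup>2) v d \<and>
        norm (v 1 - 1 - \<delta> * (\<i> * \<omega>)) \<le> e * \<delta> \<and> norm (d 1 - \<delta> * \<tau>) \<le> e * \<delta>"
    and c: "c = \<i> * \<tau> / of_real \<omega>"
  shows "kakeya_chart (\<lambda>s. exp (\<i> * of_real \<omega> * of_real s)) (\<lambda>s. c * (1 - exp (\<i> * of_real \<omega> * of_real s)))
    \<omega> \<tau> (rotation_chart c \<omega>) (pi / \<bar>\<omega>\<bar>) A"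
proof -
  have s: "screw_flow (\<lambda>s. exp (\<i> * of_real \<omega> * of_real s))
      (\<lambda>s. c * (1 - exp (\<i> * of_real \<omega> * of_real s))) \<omega> \<tau>"
  proof
    show "((\<lambda>s. exp (\<i> * of_real \<omega> * of_real s)) has_vector_derivative \<i> * of_real \<omega>) (at 0)"
      by (rule has_vector_derivative_real_field[of "\<lambda>w. exp (\<i> * of_real \<omega> * w)"])
        (auto intro!: derivative_eq_intros)
    have "c * of_real \<omega> = \<i> * \<tau>" using assms(1) by (simp add: c)
    then have "- c * (\<i> * of_real \<omega>) = - (\<i> * (\<i> * \<tau>))" by (simp add: mult.left_commute)
    then have "- c * (\<i> * of_real \<omega>) = \<tau>" by simp
    then show "((\<lambda>s. c * (1 - exp (\<i> * of_real \<omega> * of_real s))) has_vector_derivative \<tau>) (at 0)"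
      by (intro has_vector_derivative_real_field[of "\<lambda>w. c * (1 - exp (\<i> * of_real \<omega> * w))"])
        (auto intro!: derivative_eq_intros)
  qed (auto simp: exp_add algebra_simps intro!: continuous_intros)
  interpret screw_flow "\<lambda>s. exp (\<i> * of_real \<omega> * of_real s)"
    "\<lambda>s. c * (1 - exp (\<i> * of_real \<omega> * of_real s))" \<omega> \<tau> by (rule s)
  show ?thesis
  proof
    show "pi / \<bar>\<omega>\<bar> > 0" using assms(1) by simp
    show "rotation_chart c \<omega> (w + \<i> * of_real s) = flow s (rotation_chart c \<omega> w)" for w s
      unfolding rotation_chart_def flow_def by (simp add: exp_add algebra_simps)
    show "continuous_on UNIV (rotation_chart c \<omega>)"
      unfolding rotation_chart_def by (intro continuous_intros)
    show "inj_on (rotation_chart c \<omega>) {w. \<bar>Im w - y\<bar> < pi / \<bar>\<omega>\<bar>}" for y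
    proof (rule inj_onI)
      fix w w' assume w: "w \<in> {w. \<bar>Im w - y\<bar> < pi / \<bar>\<omega>\<bar>}" "w' \<in> {w. \<bar>Im w - y\<bar> < pi / \<bar>\<omega>\<bar>}"
        and eq: "rotation_chart c \<omega> w = rotation_chart c \<omega> w'"
      have "\<bar>Im w - Im w'\<bar> < 2 * (pi / \<bar>\<omega>\<bar>)" using w by auto
      then have "\<bar>\<omega>\<bar> * \<bar>Im w - Im w'\<bar> < 2 * pi" using assms(1) by (simp add: field_simps)
      then have "\<bar>Im (of_real \<omega> * w) - Im (of_real \<omega> * w')\<bar> < 2 * pi"
        by (simp add: abs_mult flip: right_diff_distrib)
      moreover have "exp (of_real \<omega> * w) = exp (of_real \<omega> * w')" using eq by (simp add: rotation_chart_def)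
      ultimately have "of_real \<omega> * w = of_real \<omega> * w'" by (rule exp_complex_eqI)
      then show "w = w'" using assms(1) by simp
    qed
    show "negligible (rotation_chart c \<omega> ` S)" if "negligible S" for S
    proof (rule negligible_differentiable_image_negligible[OF _ that])
      have "(rotation_chart c \<omega> has_field_derivative of_real \<omega> * exp (of_real \<omega> * w)) (at w within S)" for w
        unfolding rotation_chart_def by (auto intro!: derivative_eq_intros)
      then show "rotation_chart c \<omega> differentiable_on S"
        unfolding differentiable_on_def
        by (meson field_differentiable_def field_differentiable_imp_differentiable)
    qed simp
    show "negligible (rotation_chart c \<omega> -` S)" if "negligible S" for S
    proof -
      have "linear (\<lambda>w::complex. w / of_real \<omega>)"
        by (simp add: linear_iff add_divide_distrib scaleR_conv_of_real)
      moreover have "negligible (exp -` ((+) (- c) ` S))"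
        by (intro negligible_exp_vimage negligible_translation that)
      ultimately have "negligible ((\<lambda>w. w / of_real \<omega>) ` (exp -` ((+) (- c) ` S)))"
        by (intro negligible_differentiable_image_negligible linear_imp_differentiable_on) auto
      moreover have "rotation_chart c \<omega> -` S \<subseteq> (\<lambda>w. w / of_real \<omega>) ` (exp -` ((+) (- c) ` S))"
      proof
        fix w assume "w \<in> rotation_chart c \<omega> -` S"
        then have "exp (of_real \<omega> * w) \<in> (+) (- c) ` S"
          by (intro image_eqI[of _ _ "rotation_chart c \<omega> w"]) (auto simp: rotation_chart_def)
        then show "w \<in> (\<lambda>w. w / of_real \<omega>) ` (exp -` ((+) (- c) ` S))"
          using assms(1) by (intro image_eqI[of _ _ "of_real \<omega> * w"]) auto
      qed
      ultimately show ?thesis by (rule negligible_subset)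
    qed
  qed (rule assms)+
qed

text \<open>The factor \<open>- \<i> * \<tau>\<close> turns the vertical unit vector \<i> into
  \<tau>, so height is again flow time. The map is injective everywhere, and the half-height 1 is an
  arbitrary choice.\<close>

lemma kakeya_chart_translation:
  assumes "\<tau> \<noteq> 0" "closed A" "negligible A"
    and small: "\<forall>e>0. \<exists>\<delta> v d. 0 < \<delta> \<and> \<delta> < e \<and> small_move A \<delta> (\<delta>\<^sup>2) v d \<and>
        norm (v 1 - 1 - \<delta> * (\<i> * of_real 0)) \<le> e * \<delta> \<and> norm (d 1 - \<delta> * \<tau>) \<le> e * \<delta>"
  shows "kakeya_chart (\<lambda>s. 1) (\<lambda>s. of_real s * \<tau>) 0 \<tau> (\<lambda>w. - \<i> * \<tau> * w) 1 A"
proof -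
  have s: "screw_flow (\<lambda>s. 1) (\<lambda>s. of_real s * \<tau>) 0 \<tau>"
  proof
    show "((\<lambda>s. of_real s * \<tau>) has_vector_derivative \<tau>) (at 0)"
      by (rule has_vector_derivative_real_field[of "\<lambda>w. w * \<tau>"]) (auto intro!: derivative_eq_intros)
  qed (auto simp: algebra_simps intro!: continuous_intros)
  show ?thesis
  proof (intro kakeya_chart.intro kakeya_chart_axioms.intro s)
    show "- \<i> * \<tau> * (w + \<i> * of_real s) = screw_flow.flow (\<lambda>s. 1) (\<lambda>s. of_real s * \<tau>) s (- \<i> * \<tau> * w)" for w s
      unfolding screw_flow.flow_def[OF s] by (simp add: algebra_simps)
    show "continuous_on UNIV (\<lambda>w. - \<i> * \<tau> * w)" by (intro continuous_intros)
    show "inj_on (\<lambda>w. - \<i> * \<tau> * w) {w. \<bar>Im w - y\<bar> < 1}" for y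
      using assms(1) by (auto simp: inj_on_def)
    have lin: "linear (\<lambda>w. k * w)" for k :: complex
      by (simp add: linear_iff algebra_simps)
    show "negligible ((\<lambda>w. - \<i> * \<tau> * w) ` S)" if "negligible S" for S
      by (intro negligible_differentiable_image_negligible linear_imp_differentiable_on lin that) simp
    show "negligible ((\<lambda>w. - \<i> * \<tau> * w) -` S)" if "negligible S" for S
    proof (rule negligible_subset)
      show "negligible ((\<lambda>z. \<i> / \<tau> * z) ` S)" by (intro negligible_differentiable_image_negligible linear_imp_differentiable_on lin that) simp
      show "(\<lambda>w. - \<i> * \<tau> * w) -` S \<subseteq> (\<lambda>z. \<i> / \<tau> * z) ` S"
      proof
        fix w assume "w \<in> (\<lambda>w. - \<i> * \<tau> * w) -` S"
        then show "w \<in> (\<lambda>z. \<i> / \<tau> * z) ` S"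
          using assms(1) by (intro image_eqI[of _ _ "- \<i> * \<tau> * w"]) auto
      qed
    qed
  qed (rule zero_less_one assms)+
qed

section \<open>Closed connected subsets of lines and circles\<close>

text \<open>The parameters of the points of \<open>A\<close> form a closed interval; its boundedness
  above and below decides between the outcomes.\<close>

lemma closed_connected_subset_line:
  fixes A :: "complex set"
  assumes A: "closed A" "connected A" and "v \<noteq> 0" and sub: "A \<subseteq> range (\<lambda>t. p + t *\<^sub>R v)"
    and xy: "x \<in> A" "y \<in> A" "x \<noteq> y"
  shows "is_line_segment A \<or> is_half_line A \<or> is_line A"
proof -
  define l where "l t = p + t *\<^sub>R v" for t :: real
  define T where "T = l -` A"
  have inj: "l s = l t \<longleftrightarrow> s = t" for s t using \<open>v \<noteq> 0\<close> by (simp add: l_def)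
  have "A \<subseteq> range l" using sub by (simp add: l_def)
  then have A_eq: "A = l ` T" by (auto simp: T_def image_vimage_eq)
  have "T = (\<lambda>z. Re ((z - p) / v)) ` A"
    using \<open>v \<noteq> 0\<close> unfolding A_eq by (force simp: l_def scaleR_conv_of_real)
  then have conn: "connected T"
    using \<open>v \<noteq> 0\<close> by (auto intro!: connected_continuous_image A continuous_intros)
  have closed: "closed T"
    unfolding T_def l_def by (intro closed_vimage A continuous_intros)
  have Icc: "{s..t} \<subseteq> T" if "s \<in> T" "t \<in> T" for s t
    using conn that by (simp add: connected_contains_Icc)
  have ne: "T \<noteq> {}" using xy(1) A_eq by auto
  have bounds: "Sup T \<in> T" "\<And>t. t \<in> T \<Longrightarrow> t \<le> Sup T" if "bdd_above T"
    using that closed ne by (auto intro: closed_contains_Sup cSup_upper)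
  have bounds': "Inf T \<in> T" "\<And>t. t \<in> T \<Longrightarrow> Inf T \<le> t" if "bdd_below T"
    using that closed ne by (auto intro: closed_contains_Inf cInf_lower)
  have unb: "\<exists>s\<in>T. t < s" if "\<not> bdd_above T" for t
    using that unfolding bdd_above_def by (meson not_le)
  have unb': "\<exists>s\<in>T. s < t" if "\<not> bdd_below T" for t
    using that unfolding bdd_below_def by (meson not_le)
  show ?thesis
  proof (cases "bdd_above T"; cases "bdd_below T")
    assume b: "bdd_above T" "bdd_below T"
    define a b where "a = Inf T" and "b = Sup T"
    have T: "T = {a..b}"
      using bounds[OF b(1)] bounds'[OF b(2)] Icc by (fastforce simp: a_def b_def)
    obtain s t where "s \<in> T" "t \<in> T" "s \<noteq> t" using xy A_eq by (metis imageE)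
    then have "a < b" unfolding T by auto
    then have "T = closed_segment a b" by (simp add: T closed_segment_eq_real_ivl)
    then have "A = {l ((1 - u) *\<^sub>R a + u *\<^sub>R b) |u. 0 \<le> u \<and> u \<le> 1}"
      unfolding A_eq closed_segment_def by blast
    moreover have "l ((1 - u) *\<^sub>R a + u *\<^sub>R b) = (1 - u) *\<^sub>R l a + u *\<^sub>R l b" for u
      by (simp add: l_def algebra_simps)
    ultimately have "A = closed_segment (l a) (l b)" by (simp only: closed_segment_def)
    moreover have "l a \<noteq> l b" using inj \<open>a < b\<close> by simp
    ultimately show ?thesis unfolding is_line_segment_def by blast
  next
    assume b: "bdd_above T" "\<not> bdd_below T"
    have T: "T = {..Sup T}"
      using bounds[OF b(1)] unb'[OF b(2)] Icc by (fastforce dest: less_imp_le)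
    have "A = {l (Sup T) + s *\<^sub>R (- v) |s. s \<ge> 0}"
    proof (intro set_eqI iffI)
      fix z assume "z \<in> A"
      then obtain t where "t \<in> T" "z = l t" using A_eq by blast
      then show "z \<in> {l (Sup T) + s *\<^sub>R (- v) |s. s \<ge> 0}"
        using bounds(2)[OF b(1)] by (intro CollectI exI[of _ "Sup T - t"]) (auto simp: l_def algebra_simps)
    next
      fix z assume "z \<in> {l (Sup T) + s *\<^sub>R (- v) |s. s \<ge> 0}"
      then obtain s where "s \<ge> 0" "z = l (Sup T - s)" by (auto simp: l_def algebra_simps)
      then show "z \<in> A" unfolding A_eq by (subst T) auto
    qed
    then have "is_half_line A"
      using \<open>v \<noteq> 0\<close> unfolding is_half_line_def by (intro exI[of _ "l (Sup T)"] exI[of _ "- v"]) simp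
    then show ?thesis by blast
  next
    assume b: "\<not> bdd_above T" "bdd_below T"
    have T: "T = {Inf T..}"
      using bounds'[OF b(2)] unb[OF b(1)] Icc by (fastforce dest: less_imp_le)
    have "A = {l (Inf T) + s *\<^sub>R v |s. s \<ge> 0}"
    proof (intro set_eqI iffI)
      fix z assume "z \<in> A"
      then obtain t where "t \<in> T" "z = l t" using A_eq by blast
      then show "z \<in> {l (Inf T) + s *\<^sub>R v |s. s \<ge> 0}"
        using bounds'(2)[OF b(2)] by (intro CollectI exI[of _ "t - Inf T"]) (auto simp: l_def algebra_simps)
    next
      fix z assume "z \<in> {l (Inf T) + s *\<^sub>R v |s. s \<ge> 0}"
      then obtain s where "s \<ge> 0" "z = l (Inf T + s)" by (auto simp: l_def algebra_simps)
      then show "z \<in> A" unfolding A_eq by (subst T) auto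
    qed
    then have "is_half_line A"
      using \<open>v \<noteq> 0\<close> unfolding is_half_line_def by (intro exI[of _ "l (Inf T)"] exI[of _ v]) simp
    then show ?thesis by blast
  next
    assume b: "\<not> bdd_above T" "\<not> bdd_below T"
    have "T = UNIV"
    proof (rule set_eqI)
      fix t
      obtain s s' where "s \<in> T" "s' \<in> T" "s < t" "t < s'" using unb[OF b(1)] unb'[OF b(2)] by meson
      then show "t \<in> T \<longleftrightarrow> t \<in> UNIV" using Icc[of s s'] by auto
    qed
    then have "A = affine hull {p, p + v}"
      unfolding A_eq affine_hull_2_alt by (auto simp: l_def)
    then have "is_line A"
      using \<open>v \<noteq> 0\<close> unfolding is_line_def by (intro exI[of _ p] exI[of _ "p + v"]) simp
    then show ?thesis by blast
  qed
qed

text \<open>If \<open>A\<close> misses a point \<open>q\<close> of the circle, angles are measured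
  from the antipode of \<open>q\<close>. Then \<open>q\<close> sits on the branch cut of the
  logarithm, and the angle \<open>g\<close> maps \<open>A\<close> continuously onto a compact
  interval.\<close>

lemma closed_connected_subset_circle:
  fixes A :: "complex set"
  assumes A: "closed A" "connected A" and "r > 0" and sub: "A \<subseteq> sphere c r"
    and xy: "x \<in> A" "y \<in> A" "x \<noteq> y"
  shows "is_circular_arc A \<or> is_circle A"
proof (cases "A = sphere c r")
  case True
  then show ?thesis using \<open>r > 0\<close> unfolding is_circle_def by blast
next
  case False
  then obtain q where q: "q \<in> sphere c r" "q \<notin> A" using sub by blast
  define \<phi> where "\<phi> = Arg (c - q)"
  have cq: "c - q = of_real r * cis \<phi>" "norm (c - q) = r" "c - q \<noteq> 0"
    using q(1) rcis_cmod_Arg[of "c - q"] \<open>r > 0\<close> by (auto simp: \<phi>_def rcis_def dist_norm)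
  define f where "f z = (z - c) / (c - q)" for z
  define g where "g z = Im (Ln (f z))" for z
  have f: "norm (f z) = 1" "f z \<notin> \<real>\<^sub>\<le>\<^sub>0" if "z \<in> A" for z
  proof -
    show 1: "norm (f z) = 1"
      using that sub cq \<open>r > 0\<close> by (auto simp: f_def norm_divide dist_norm norm_minus_commute)
    show "f z \<notin> \<real>\<^sub>\<le>\<^sub>0"
    proof
      assume "f z \<in> \<real>\<^sub>\<le>\<^sub>0"
      then obtain t where t: "t \<le> 0" "f z = of_real t" by (auto elim: nonpos_Reals_cases)
      then have "f z = -1" using 1 by auto
      then have "z = q" using cq(3) by (simp add: f_def field_simps)
      then show False using that q by simp
    qed
  qed
  have contf: "continuous_on A f" unfolding f_def using cq(3) by (intro continuous_intros) auto
  have contg: "continuous_on A g"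
    unfolding g_def using f by (intro continuous_intros contf) auto
  have "bounded A" using sub bounded_subset bounded_sphere by blast
  then have "compact A" using A(1) compact_eq_bounded_closed by blast
  then have "compact (g ` A)" "connected (g ` A)"
    using contg A(2) by (auto intro: compact_continuous_image connected_continuous_image)
  then obtain a b where ab: "g ` A = {a..b}" using connected_compact_interval_1[of "g ` A"] by auto
  have z_eq: "z = c + of_real r * cis (\<phi> + g z)" if "z \<in> A" for z
  proof -
    have nz: "f z \<noteq> 0" using f(1)[OF that] by auto
    have "f z = exp (Ln (f z))" using nz by simp
    also have "Ln (f z) = \<i> * g z"
      using f(1)[OF that] nz by (simp add: complex_eq_iff g_def)
    finally have "f z = cis (g z)" by (simp add: cis_conv_exp)
    moreover have "z = c + (c - q) * f z" using cq(3) by (simp add: f_def)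
    ultimately show ?thesis by (simp add: cq(1) mult.assoc flip: cis_mult)
  qed
  have g_bound: "- pi < g z" "g z < pi" if "z \<in> A" for z
  proof -
    have nz: "f z \<noteq> 0" using f(1)[OF that] by auto
    show "- pi < g z" using nz by (simp add: g_def mpi_less_Im_Ln)
    have "Im (Ln (f z)) \<noteq> pi"
      using f(2)[OF that] nz Arg_eq_pi by (metis Arg_eq_Im_Ln complex_nonpos_Reals_iff less_eq_real_def)
    then show "g z < pi" using Im_Ln_le_pi[OF nz] by (simp add: g_def)
  qed
  have "g x \<noteq> g y" using z_eq xy by metis
  moreover have "g x \<in> {a..b}" "g y \<in> {a..b}" using xy ab by blast+
  ultimately have "a < b" by auto
  then have "a \<in> g ` A" "b \<in> g ` A" using ab by auto
  \<comment> \<open>Both ends are attained, and angles of points of \<open>A\<close> lie strictly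
    between -pi and pi; this excludes the full circle.\<close>
  then have "b < a + 2 * pi" using g_bound by fastforce
  have "A = {c + of_real r * cis \<theta> | \<theta>. \<theta> \<in> {\<phi> + a..\<phi> + b}}"
  proof (intro set_eqI iffI)
    fix z assume z: "z \<in> A"
    then have "g z \<in> {a..b}" using ab by blast
    then show "z \<in> {c + of_real r * cis \<theta> | \<theta>. \<theta> \<in> {\<phi> + a..\<phi> + b}}"
      using z_eq[OF z] by (intro CollectI exI[of _ "\<phi> + g z"]) auto
  next
    fix z assume "z \<in> {c + of_real r * cis \<theta> | \<theta>. \<theta> \<in> {\<phi> + a..\<phi> + b}}"
    then obtain \<theta> where \<theta>: "\<theta> \<in> {\<phi> + a..\<phi> + b}" "z = c + of_real r * cis \<theta>" by blast
    then have "\<theta> - \<phi> \<in> g ` A" unfolding ab by auto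
    then obtain z' where "z' \<in> A" "\<theta> = \<phi> + g z'" by (metis imageE add_diff_cancel_left' diff_add_cancel add.commute)
    then show "z \<in> A" using z_eq \<theta>(2) by metis
  qed
  then show ?thesis
    using \<open>r > 0\<close> \<open>a < b\<close> \<open>b < a + 2 * pi\<close> unfolding is_circular_arc_def
    by (intro disjI1 exI[of _ c] exI[of _ r] exI[of _ "\<phi> + a"] exI[of _ "\<phi> + b"]) auto
qed

section \<open>The Kakeya property\<close>

text \<open>A movement starts at the identity, so \<open>A\<close> is part of every swept
  set.\<close>

lemma kakeya_negligible:
  assumes "kakeya_property A"
  shows "negligible A"
  unfolding negligible_outer
proof (intro allI impI)
  fix e :: real assume e: "e > 0"
  obtain M where M: "continuous_movement M" "swept M A \<in> sets lebesgue"
      "emeasure lebesgue (swept M A) < ennreal e"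
    using assms e unfolding kakeya_property_def by blast
  have "A \<subseteq> swept M A"
  proof
    fix x assume "x \<in> A"
    moreover have "M 0 x = x" using M(1) by (simp add: continuous_movement_def)
    ultimately show "x \<in> swept M A" unfolding swept_def by force
  qed
  moreover have "swept M A \<in> lmeasurable"
    using M(2) order.strict_trans[OF M(3) ennreal_less_top] by (simp add: fmeasurable_def)
  moreover from this have "measure lebesgue (swept M A) < e"
    using M(3) e by (simp add: emeasure_eq_measure2 ennreal_less_iff)
  ultimately show "\<exists>T. A \<subseteq> T \<and> T \<in> lmeasurable \<and> measure lebesgue T < e" by blast
qed

lemma nontrivial_components_connected:
  assumes "connected A" "x \<in> A" "y \<in> A" "x \<noteq> y"
  shows "A \<in> nontrivial_components A"
  using assms components_eq_sing_iff[of A] by (auto simp: nontrivial_components_def)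

theorem theorem1p1:
  fixes A :: "complex set"
  assumes "closed A" and "kakeya_property A"
  shows "trivial_K_set (\<Union>(nontrivial_components A)) \<and>
    (A \<noteq> {} \<and> connected A \<longrightarrow>
       is_line_segment A \<or> is_half_line A \<or> is_line A \<or>
       is_circular_arc A \<or> is_circle A \<or> (\<exists>a. A = {a}))"
proof -
  obtain \<omega> :: real and \<tau> :: complex where nz: "\<omega> \<noteq> 0 \<or> \<tau> \<noteq> 0"
    and small: "\<forall>e>0. \<exists>\<delta> v d. 0 < \<delta> \<and> \<delta> < e \<and> small_move A \<delta> (\<delta>\<^sup>2) v d \<and>
        norm (v 1 - 1 - \<delta> * (\<i> * \<omega>)) \<le> e * \<delta> \<and> norm (d 1 - \<delta> * \<tau>) \<le> e * \<delta>"
    using kakeya_generator[OF assms(2)] by blast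
  have neg: "negligible A" by (rule kakeya_negligible[OF assms(2)])
  show ?thesis
  proof (cases "\<omega> = 0")
    case False
    define c where "c = \<i> * \<tau> / of_real \<omega>"
    interpret kakeya_chart "\<lambda>s. exp (\<i> * of_real \<omega> * of_real s)"
      "\<lambda>s. c * (1 - exp (\<i> * of_real \<omega> * of_real s))" \<omega> \<tau> "rotation_chart c \<omega>" "pi / \<bar>\<omega>\<bar>" A
      by (rule kakeya_chart_rotation[OF False assms(1) neg small c_def])
    \<comment> \<open>Arcs lying in \<open>A\<close> are completed to whole orbits, here circles
      about \<open>c\<close>.\<close>
    define N where "N = rotation_chart c \<omega> ` (Re -` arc_abscissae)"
    have "N \<in> null_sets lebesgue"
      using negligible_nontrivial_cover by (simp add: N_def negligible_iff_null_sets)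
    moreover have "N = (\<Union>r\<in>(\<lambda>x. exp (\<omega> * x)) ` arc_abscissae. sphere c r)"
    proof (intro set_eqI iffI)
      fix z assume "z \<in> N"
      then show "z \<in> (\<Union>r\<in>(\<lambda>x. exp (\<omega> * x)) ` arc_abscissae. sphere c r)"
        using dist_rotation_chart by (auto simp: N_def)
    next
      fix z assume "z \<in> (\<Union>r\<in>(\<lambda>x. exp (\<omega> * x)) ` arc_abscissae. sphere c r)"
      then obtain x where x: "x \<in> arc_abscissae" "dist c z = exp (\<omega> * x)" by auto
      then have "z \<noteq> c" by (metis dist_self exp_not_eq_zero)
      then obtain w where w: "rotation_chart c \<omega> w = z" "Re w = ln (dist c z) / \<omega>"
        using rotation_chart_surj False by metis
      then have "Re w = x" using x(2) False by simp
      then show "z \<in> N" using w(1) x(1) unfolding N_def by blast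
    qed
    then have "union_of_concentric_circles N"
      unfolding union_of_concentric_circles_def
      by (intro exI[of _ c] exI[of _ "(\<lambda>x. exp (\<omega> * x)) ` arc_abscissae"]) auto
    moreover have "\<Union>(nontrivial_components A) \<subseteq> N"
    proof
      fix z assume "z \<in> \<Union>(nontrivial_components A)"
      then obtain C where C: "C \<in> nontrivial_components A" "z \<in> C" by blast
      \<comment> \<open>This rules out the centre, the one point that the chart does not
        reach.\<close>
      obtain r where "r > 0" "C \<subseteq> sphere c r"
        using nontrivial_component_subset_sphere[OF refl False C(1)] by blast
      then have "z \<noteq> c" using C(2) by auto
      then obtain w where w: "rotation_chart c \<omega> w = z"
        using rotation_chart_surj False by metis
      then have "Re w \<in> arc_abscissae" using Re_mem_arc_abscissae[OF C(1)] C(2) by simp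
      then show "z \<in> N" using w unfolding N_def by blast
    qed
    ultimately have "trivial_K_set (\<Union>(nontrivial_components A))"
      unfolding trivial_K_set_def by blast
    moreover have "is_circular_arc A \<or> is_circle A"
      if xy: "connected A" "x \<in> A" "y \<in> A" "x \<noteq> y" for x y
    proof -
      obtain r where "r > 0" "A \<subseteq> sphere c r"
        using nontrivial_component_subset_sphere[OF refl False nontrivial_components_connected[OF xy]] by blast
      then show ?thesis using closed_connected_subset_circle[OF assms(1)] xy by blast
    qed
    moreover have "(\<exists>a. A = {a}) \<or> (\<exists>x\<in>A. \<exists>y\<in>A. x \<noteq> y)" if "A \<noteq> {}" using that by blast
    ultimately show ?thesis by blast
  next
    case True
    then have "\<tau> \<noteq> 0" using nz by simp
    interpret kakeya_chart "\<lambda>s. 1" "\<lambda>s. of_real s * \<tau>" 0 \<tau> "\<lambda>w. - \<i> * \<tau> * w" 1 A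
      by (rule kakeya_chart_translation[OF \<open>\<tau> \<noteq> 0\<close> assms(1) neg small[unfolded True]])
    \<comment> \<open>The orbit with abscissa x, written as an affine hull to match
      \<open>is_line\<close>.\<close>
    define l where "l x = affine hull {- \<i> * \<tau> * of_real x, - \<i> * \<tau> * of_real x + \<tau>}" for x :: real
    have l: "l x = (\<lambda>w. - \<i> * \<tau> * w) ` (Re -` {x})" for x
    proof (intro set_eqI iffI)
      fix z assume "z \<in> l x"
      then obtain t where "z = - \<i> * \<tau> * of_real x + t *\<^sub>R \<tau>"
        unfolding l_def affine_hull_2_alt by auto
      then show "z \<in> (\<lambda>w. - \<i> * \<tau> * w) ` (Re -` {x})"
        by (intro image_eqI[of _ _ "Complex x t"]) (auto simp: Complex_eq scaleR_conv_of_real algebra_simps)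
    next
      fix z assume "z \<in> (\<lambda>w. - \<i> * \<tau> * w) ` (Re -` {x})"
      then obtain w where w: "z = - \<i> * \<tau> * w" "Re w = x" by auto
      then have "w = of_real x + \<i> * of_real (Im w)" by (simp add: complex_eq_iff)
      then have "z = - \<i> * \<tau> * (of_real x + \<i> * of_real (Im w))" using w(1) by simp
      also have "\<dots> = - \<i> * \<tau> * of_real x + Im w *\<^sub>R \<tau>"
        by (simp add: scaleR_conv_of_real algebra_simps)
      finally have "z = - \<i> * \<tau> * of_real x + Im w *\<^sub>R \<tau>" .
      then show "z \<in> l x" unfolding l_def affine_hull_2_alt by auto
    qed
    define H where "H = arc_abscissae"
    define N where "N = \<Union>(l ` H)"
    have "N = (\<lambda>w. - \<i> * \<tau> * w) ` (Re -` H)" unfolding N_def l by blast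
    then have N: "N \<in> null_sets lebesgue" "\<And>w. Re w \<in> H \<Longrightarrow> - \<i> * \<tau> * w \<in> N"
      using negligible_nontrivial_cover by (auto simp: negligible_iff_null_sets H_def)
    have "is_line (l x)" for x
      unfolding is_line_def l_def using \<open>\<tau> \<noteq> 0\<close> by (metis add_cancel_right_right)
    moreover have "affine_parallel (l x) (l y)" for x y
    proof -
      have "l y = (+) (- \<i> * \<tau> * of_real y - (- \<i> * \<tau> * of_real x)) ` l x"
        unfolding l_def affine_hull_translation[symmetric] by (simp add: algebra_simps)
      then show ?thesis unfolding affine_parallel_def by blast
    qed
    ultimately have "union_of_parallel_lines N"
      unfolding union_of_parallel_lines_def N_def by (intro exI[of _ "l ` H"]) auto
    moreover have "\<Union>(nontrivial_components A) \<subseteq> N"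
    proof
      fix z assume "z \<in> \<Union>(nontrivial_components A)"
      then obtain C where C: "C \<in> nontrivial_components A" "z \<in> C" by blast
      have "- \<i> * \<tau> * (\<i> * z / \<tau>) = z" using \<open>\<tau> \<noteq> 0\<close> by simp
      then show "z \<in> N"
        using N(2)[of "\<i> * z / \<tau>"] Re_mem_arc_abscissae[OF C(1), of "\<i> * z / \<tau>", folded H_def] C(2) by simp
    qed
    ultimately have "trivial_K_set (\<Union>(nontrivial_components A))"
      using N(1) unfolding trivial_K_set_def by blast
    moreover have "is_line_segment A \<or> is_half_line A \<or> is_line A"
      if xy: "connected A" "x \<in> A" "y \<in> A" "x \<noteq> y" for x y
    proof -
      obtain p where "A \<subseteq> range (\<lambda>t. p + t *\<^sub>R \<tau>)"
        using nontrivial_component_subset_line[OF refl \<open>\<tau> \<noteq> 0\<close> nontrivial_components_connected[OF xy]] by blast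
      then show ?thesis using closed_connected_subset_line[OF assms(1)] xy \<open>\<tau> \<noteq> 0\<close> by blast
    qed
    moreover have "(\<exists>a. A = {a}) \<or> (\<exists>x\<in>A. \<exists>y\<in>A. x \<noteq> y)" if "A \<noteq> {}" using that by blast
    ultimately show ?thesis by blast
  qed
qed

end
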